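(* Let $\mathcal{K}$ be a class of subordination algebras. The following are equivalent: 1. $\mathcal{K}=\mathrm{Mod}(L)$ for some normal modal logic $L$; 2. $\mathcal{K}$ is definable by schemes of modal formulas; 3. $\mathcal{K}$ is closed under subalgebras and morphic images (in the category $\mathbf{Sub}$), under products of good families and under modalisation, and reflects modalisation (i.e. $\underline{B}^m\in\mathcal{K}$ implies $\underline{B}\in\mathcal{K}$); 4. $\mathcal{K}$ is closed under subalgebras and morphic images (in $\mathbf{Sub}$), and for every family $(\underline{B}_i\mid i\in I)$ of subordination algebras, $\prod_i\underline{B}_i^m\in\mathcal{K}$ if and only if $\underline{B}_i\in\mathcal{K}$ for all $i\in I$.
   Context: A subordination algebra is a pair $(B,\prec)$, $B$ a Boolean algebra, $\prec\subseteq B\times B$ with: $0\prec 0$, $1\prec 1$; $a\prec b,c\Rightarrow a\prec b\wedge c$; $b,c\prec a\Rightarrow b\vee c\prec a$; $a\le b\prec c\le d\Rightarrow a\prec d$. A modal algebra $(B,\lozenge)$ is regarded as a subordination algebra via $a\prec b$ iff $\lozenge a\le b$. Morphisms of $\mathbf{Sub}$: Boolean homomorphisms $f:B\to C$ such that $a\prec b\Rightarrow f(a)\prec f(b)$, and $f(a)\prec c\Rightarrow\exists b\,(a\prec b$ and $f(b)\le c)$. A subalgebra of $(B,\prec)$ is a Boolean subalgebra $A$ (with restricted $\prec$) such that $a\in A$, $b\in B$, $a\prec b$ imply $a\prec c\le b$ for some $c\in A$; a morphic image is the codomain of a surjective $\mathbf{Sub}$-morphism. Products are Cartesian with pointwise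 $\prec$. The dual of $(B,\prec)$ is $(X,R)$ with $X$ the ultrafilter space of $B$ (clopen basis $r(b)=\{x: b\in x\}$) and $xRy$ iff $\{b:\exists a\in y, a\prec b\}\subseteq x$; $\underline{B}^\delta$ is $(\mathcal{P}(X),\lozenge)$ with $\lozenge E=\{x:\exists y\in E, xRy\}$. The modalisation $\underline{B}^m$ is the modal subalgebra of $\underline{B}^\delta$ generated by $r(B)$ (regarded as a subordination algebra). A modal formula $\varphi$ is valid in $\underline{B}$ if for every map $v$ from variables to $B$, the homomorphic extension of $p\mapsto r(v(p))$ into $(\mathcal{P}(X),\lozenge)$ sends $\varphi$ to $X$. $\mathrm{Mod}(L)$ is the class of subordination algebras validating every formula of $L$; "definable by schemes" means $\mathcal{K}$ is the class of those subordination algebras validating all substitution instances of the formulas of some set of modal formulas. Good families: for subordination algebras $\underline{A}_j$ ($j\in J$) with product $P=\prod_j\underline{A}_j$ and projections $p_j$, let $f:\mathcal{P}(\mathrm{Ult}(P))\to\prod_j\mathcal{P}(\mathrm{Ult}(A_j))$ be $f(E)=(\{y\in\mathrm{Ult}(A_j): p_j^{-1}(y)\in E\})_j$; its restriction $f^m$ maps $P^m$ into $\prod_j\underline{A}_j^m$. The family is good if $f^m$ is injective. *)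

theory Defs
  imports "HOL.Hull" "HOL-Library.Equipollence" "HOL-Library.FuncSet"
begin

section \<open>Boolean, subordination and modal algebras\<close>

text \<open>
  Algebras have explicit carriers. Values of the operations and of the relation outside the
  carrier are irrelevant: every axiom and every construction is relativised to the carrier.
  The one-element algebra is allowed.
\<close>

record 'a balg =
  carrier :: "'a set"
  meet :: "'a \<Rightarrow> 'a \<Rightarrow> 'a"
  join :: "'a \<Rightarrow> 'a \<Rightarrow> 'a"
  neg :: "'a \<Rightarrow> 'a"
  bzero :: 'a
  bone :: 'a

record 'a subord = "'a balg" +
  prec :: "'a \<Rightarrow> 'a \<Rightarrow> bool"

record 'a modal = "'a balg" +
  dia :: "'a \<Rightarrow> 'a"

definition ble :: "('a, 'm) balg_scheme \<Rightarrow> 'a \<Rightarrow> 'a \<Rightarrow> bool" where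
  "ble B a b \<longleftrightarrow> meet B a b = a"

definition boolean_subuniverse :: "('a, 'm) balg_scheme \<Rightarrow> 'a set \<Rightarrow> bool" where
  "boolean_subuniverse B S \<longleftrightarrow>
     S \<subseteq> carrier B \<and> bzero B \<in> S \<and> bone B \<in> S \<and>
     (\<forall>a\<in>S. neg B a \<in> S) \<and> (\<forall>a\<in>S. \<forall>b\<in>S. meet B a b \<in> S \<and> join B a b \<in> S)"

text \<open>The equations are those of the library locale \<open>abstract_boolean_algebra\<close>.\<close>

definition boolean_alg :: "('a, 'm) balg_scheme \<Rightarrow> bool" where
  "boolean_alg B \<longleftrightarrow>
     boolean_subuniverse B (carrier B) \<and>
     (\<forall>a\<in>carrier B. \<forall>b\<in>carrier B. \<forall>c\<in>carrier B.
        meet B (meet B a b) c = meet B a (meet B b c) \<and>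
        join B (join B a b) c = join B a (join B b c) \<and>
        meet B a (join B b c) = join B (meet B a b) (meet B a c) \<and>
        join B a (meet B b c) = meet B (join B a b) (join B a c)) \<and>
     (\<forall>a\<in>carrier B. \<forall>b\<in>carrier B. meet B a b = meet B b a \<and> join B a b = join B b a) \<and>
     (\<forall>a\<in>carrier B.
        meet B a (bone B) = a \<and> join B a (bzero B) = a \<and>
        meet B a (neg B a) = bzero B \<and> join B a (neg B a) = bone B)"

definition subordination_alg :: "'a subord \<Rightarrow> bool" where
  "subordination_alg B \<longleftrightarrow>
     boolean_alg B \<and>
     prec B (bzero B) (bzero B) \<and> prec B (bone B) (bone B) \<and>
     (\<forall>a\<in>carrier B. \<forall>b\<in>carrier B. \<forall>c\<in>carrier B.
        prec B a b \<longrightarrow> prec B a c \<longrightarrow> prec B a (meet B b c)) \<and>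
     (\<forall>a\<in>carrier B. \<forall>b\<in>carrier B. \<forall>c\<in>carrier B.
        prec B b a \<longrightarrow> prec B c a \<longrightarrow> prec B (join B b c) a) \<and>
     (\<forall>a\<in>carrier B. \<forall>b\<in>carrier B. \<forall>c\<in>carrier B. \<forall>d\<in>carrier B.
        ble B a b \<longrightarrow> prec B b c \<longrightarrow> ble B c d \<longrightarrow> prec B a d)"

definition sub_of_modal :: "'a modal \<Rightarrow> 'a subord" where
  "sub_of_modal M =
     \<lparr>carrier = carrier M, meet = meet M, join = join M, neg = neg M,
      bzero = bzero M, bone = bone M, prec = (\<lambda>a b. ble M (dia M a) b)\<rparr>"

definition modal_subuniverse :: "'a modal \<Rightarrow> 'a set \<Rightarrow> bool" where
  "modal_subuniverse M S \<longleftrightarrow> boolean_subuniverse M S \<and> (\<forall>a\<in>S. dia M a \<in> S)"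


section \<open>The category of subordination algebras\<close>

definition boolean_hom ::
  "('a, 'm) balg_scheme \<Rightarrow> ('b, 'n) balg_scheme \<Rightarrow> ('a \<Rightarrow> 'b) \<Rightarrow> bool" where
  "boolean_hom B C f \<longleftrightarrow>
     f \<in> carrier B \<rightarrow> carrier C \<and> f (bzero B) = bzero C \<and> f (bone B) = bone C \<and>
     (\<forall>a\<in>carrier B. f (neg B a) = neg C (f a)) \<and>
     (\<forall>a\<in>carrier B. \<forall>b\<in>carrier B.
        f (meet B a b) = meet C (f a) (f b) \<and> f (join B a b) = join C (f a) (f b))"

definition sub_morphism :: "'a subord \<Rightarrow> 'b subord \<Rightarrow> ('a \<Rightarrow> 'b) \<Rightarrow> bool" where
  "sub_morphism B C f \<longleftrightarrow>
     boolean_hom B C f \<and>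
     (\<forall>a\<in>carrier B. \<forall>b\<in>carrier B. prec B a b \<longrightarrow> prec C (f a) (f b)) \<and>
     (\<forall>a\<in>carrier B. \<forall>c\<in>carrier C. prec C (f a) c \<longrightarrow>
        (\<exists>b\<in>carrier B. prec B a b \<and> ble C (f b) c))"

definition sub_iso :: "'a subord \<Rightarrow> 'b subord \<Rightarrow> bool" where
  "sub_iso B C \<longleftrightarrow>
     (\<exists>f. boolean_hom B C f \<and> bij_betw f (carrier B) (carrier C) \<and>
          (\<forall>a\<in>carrier B. \<forall>b\<in>carrier B. prec B a b \<longleftrightarrow> prec C (f a) (f b)))"

definition morphic_image :: "'a subord \<Rightarrow> 'b subord \<Rightarrow> bool" where
  "morphic_image B C \<longleftrightarrow> (\<exists>f. sub_morphism B C f \<and> f ` carrier B = carrier C)"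

definition sub_subuniverse :: "'a subord \<Rightarrow> 'a set \<Rightarrow> bool" where
  "sub_subuniverse B S \<longleftrightarrow>
     boolean_subuniverse B S \<and>
     (\<forall>a\<in>S. \<forall>b\<in>carrier B. prec B a b \<longrightarrow> (\<exists>c\<in>S. prec B a c \<and> ble B c b))"

definition prod_alg :: "'i set \<Rightarrow> ('i \<Rightarrow> 'a subord) \<Rightarrow> ('i \<Rightarrow> 'a) subord" where
  "prod_alg I A =
     \<lparr>carrier = (\<Pi>\<^sub>E i\<in>I. carrier (A i)),
      meet = (\<lambda>a b. \<lambda>i\<in>I. meet (A i) (a i) (b i)),
      join = (\<lambda>a b. \<lambda>i\<in>I. join (A i) (a i) (b i)),
      neg = (\<lambda>a. \<lambda>i\<in>I. neg (A i) (a i)),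
      bzero = (\<lambda>i\<in>I. bzero (A i)),
      bone = (\<lambda>i\<in>I. bone (A i)),
      prec = (\<lambda>a b. \<forall>i\<in>I. prec (A i) (a i) (b i))\<rparr>"


section \<open>Duality and modalisation\<close>

definition Ult :: "('a, 'm) balg_scheme \<Rightarrow> 'a set set" where
  "Ult B =
     {x. x \<subseteq> carrier B \<and> bone B \<in> x \<and> bzero B \<notin> x \<and>
         (\<forall>a\<in>x. \<forall>b\<in>x. meet B a b \<in> x) \<and>
         (\<forall>a\<in>x. \<forall>b\<in>carrier B. ble B a b \<longrightarrow> b \<in> x) \<and>
         (\<forall>a\<in>carrier B. a \<in> x \<or> neg B a \<in> x)}"

definition dual_rel :: "'a subord \<Rightarrow> 'a set \<Rightarrow> 'a set \<Rightarrow> bool" where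
  "dual_rel B x y \<longleftrightarrow> {b \<in> carrier B. \<exists>a\<in>y. prec B a b} \<subseteq> x"

definition ult_rep :: "'a subord \<Rightarrow> 'a \<Rightarrow> 'a set set" where
  "ult_rep B b = {x \<in> Ult B. b \<in> x}"

definition delta :: "'a subord \<Rightarrow> 'a set set modal" where
  "delta B =
     \<lparr>carrier = Pow (Ult B), meet = (\<inter>), join = (\<union>), neg = (\<lambda>E. Ult B - E),
      bzero = {}, bone = Ult B,
      dia = (\<lambda>E. {x \<in> Ult B. \<exists>y\<in>E. dual_rel B x y})\<rparr>"

definition modalisation :: "'a subord \<Rightarrow> 'a set set subord" where
  "modalisation B =
     sub_of_modal ((delta B)\<lparr>carrier := modal_subuniverse (delta B) hull (ult_rep B ` carrier B)\<rparr>)"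

definition good_map ::
  "'i set \<Rightarrow> ('i \<Rightarrow> 'a subord) \<Rightarrow> ('i \<Rightarrow> 'a) set set \<Rightarrow> 'i \<Rightarrow> 'a set set" where
  "good_map J A E = (\<lambda>j\<in>J. {y \<in> Ult (A j). {a \<in> carrier (prod_alg J A). a j \<in> y} \<in> E})"

definition good_family :: "'i set \<Rightarrow> ('i \<Rightarrow> 'a subord) \<Rightarrow> bool" where
  "good_family J A \<longleftrightarrow> inj_on (good_map J A) (carrier (modalisation (prod_alg J A)))"


section \<open>Modal formulas and normal modal logics\<close>

datatype fm = Var nat | Bot | Neg fm | Conj fm fm | Disj fm fm | Dia fm

abbreviation Imp :: "fm \<Rightarrow> fm \<Rightarrow> fm" where
  "Imp \<phi> \<psi> \<equiv> Disj (Neg \<phi>) \<psi>"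

abbreviation Iff :: "fm \<Rightarrow> fm \<Rightarrow> fm" where
  "Iff \<phi> \<psi> \<equiv> Conj (Imp \<phi> \<psi>) (Imp \<psi> \<phi>)"

abbreviation Box :: "fm \<Rightarrow> fm" where
  "Box \<phi> \<equiv> Neg (Dia (Neg \<phi>))"

primrec subst :: "(nat \<Rightarrow> fm) \<Rightarrow> fm \<Rightarrow> fm" where
  "subst \<sigma> (Var p) = \<sigma> p"
| "subst \<sigma> Bot = Bot"
| "subst \<sigma> (Neg \<phi>) = Neg (subst \<sigma> \<phi>)"
| "subst \<sigma> (Conj \<phi> \<psi>) = Conj (subst \<sigma> \<phi>) (subst \<sigma> \<psi>)"
| "subst \<sigma> (Disj \<phi> \<psi>) = Disj (subst \<sigma> \<phi>) (subst \<sigma> \<psi>)"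
| "subst \<sigma> (Dia \<phi>) = Dia (subst \<sigma> \<phi>)"

text \<open>Classical truth, with variables and diamond formulas treated as propositional atoms.\<close>

primrec ptrue :: "(fm \<Rightarrow> bool) \<Rightarrow> fm \<Rightarrow> bool" where
  "ptrue w (Var p) \<longleftrightarrow> w (Var p)"
| "ptrue w Bot \<longleftrightarrow> False"
| "ptrue w (Neg \<phi>) \<longleftrightarrow> \<not> ptrue w \<phi>"
| "ptrue w (Conj \<phi> \<psi>) \<longleftrightarrow> ptrue w \<phi> \<and> ptrue w \<psi>"
| "ptrue w (Disj \<phi> \<psi>) \<longleftrightarrow> ptrue w \<phi> \<or> ptrue w \<psi>"
| "ptrue w (Dia \<phi>) \<longleftrightarrow> w (Dia \<phi>)"

definition tautology :: "fm \<Rightarrow> bool" where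
  "tautology \<phi> \<longleftrightarrow> (\<forall>w. ptrue w \<phi>)"

text \<open>
  The diamond is primitive and the box is an abbreviation, hence the duality axiom next to
  the axiom K. The inconsistent logic is not excluded.
\<close>

definition normal_modal_logic :: "fm set \<Rightarrow> bool" where
  "normal_modal_logic L \<longleftrightarrow>
     (\<forall>\<phi>. tautology \<phi> \<longrightarrow> \<phi> \<in> L) \<and>
     Imp (Box (Imp (Var 0) (Var 1))) (Imp (Box (Var 0)) (Box (Var 1))) \<in> L \<and>
     Iff (Dia (Var 0)) (Neg (Box (Neg (Var 0)))) \<in> L \<and>
     (\<forall>\<phi> \<psi>. \<phi> \<in> L \<longrightarrow> Imp \<phi> \<psi> \<in> L \<longrightarrow> \<psi> \<in> L) \<and>
     (\<forall>\<phi> \<sigma>. \<phi> \<in> L \<longrightarrow> subst \<sigma> \<phi> \<in> L) \<and>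
     (\<forall>\<phi>. \<phi> \<in> L \<longrightarrow> Box \<phi> \<in> L)"

primrec interp :: "'a modal \<Rightarrow> (nat \<Rightarrow> 'a) \<Rightarrow> fm \<Rightarrow> 'a" where
  "interp M v (Var p) = v p"
| "interp M v Bot = bzero M"
| "interp M v (Neg \<phi>) = neg M (interp M v \<phi>)"
| "interp M v (Conj \<phi> \<psi>) = meet M (interp M v \<phi>) (interp M v \<psi>)"
| "interp M v (Disj \<phi> \<psi>) = join M (interp M v \<phi>) (interp M v \<psi>)"
| "interp M v (Dia \<phi>) = dia M (interp M v \<phi>)"

definition valid :: "'a subord \<Rightarrow> fm \<Rightarrow> bool" where
  "valid B \<phi> \<longleftrightarrow>
     (\<forall>v. range v \<subseteq> carrier B \<longrightarrow> interp (delta B) (\<lambda>p. ult_rep B (v p)) \<phi> = Ult B)"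


section \<open>Classes of subordination algebras\<close>

text \<open>
  HOL has no type of all sets, so ``class'' is read relative to a type \<open>'u\<close> that plays the role
  of the set-theoretic universe: its cardinality is an uncountable strong limit, a ``set'' is
  anything of smaller cardinality (\<open>small\<close>), and a class is a collection of algebras
  with small carriers in \<open>'u\<close>. Every small algebra on another type has an isomorphic
  copy on \<open>'u\<close>; \<open>belongs\<close> says that such a copy is in the class. Regularity of the cardinal is
  not assumed, so a small product of small algebras need not be small; the closure
  conditions speak about the products that are. For a regular (hence strongly inaccessible)
  cardinal these are all products of small families.
\<close>

definition small :: "'u itself \<Rightarrow> 'a set \<Rightarrow> bool" where
  "small U S \<longleftrightarrow> S \<prec> (UNIV :: 'u set)"

definition is_universe :: "'u itself \<Rightarrow> bool" where
  "is_universe U \<longleftrightarrow> small U (UNIV :: nat set) \<and> (\<forall>S :: 'u set. small U S \<longrightarrow> small U (Pow S))"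

definition SubAlg :: "'u subord set" where
  "SubAlg = {B. subordination_alg B \<and> small TYPE('u) (carrier B)}"

definition belongs :: "'a subord \<Rightarrow> 'u subord set \<Rightarrow> bool" where
  "belongs A K \<longleftrightarrow> (\<exists>C\<in>K. sub_iso C A)"

definition Mod :: "fm set \<Rightarrow> 'u subord set" where
  "Mod L = {B \<in> SubAlg. \<forall>\<phi>\<in>L. valid B \<phi>}"

definition definable_by_schemes :: "'u subord set \<Rightarrow> bool" where
  "definable_by_schemes K \<longleftrightarrow> (\<exists>\<Gamma>. K = {B \<in> SubAlg. \<forall>\<phi>\<in>\<Gamma>. \<forall>\<sigma>. valid B (subst \<sigma> \<phi>)})"

definition closed_subalgebras :: "'u subord set \<Rightarrow> bool" where
  "closed_subalgebras K \<longleftrightarrow> (\<forall>B\<in>K. \<forall>S. sub_subuniverse B S \<longrightarrow> B\<lparr>carrier := S\<rparr> \<in> K)"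

definition closed_morphic_images :: "'u subord set \<Rightarrow> bool" where
  "closed_morphic_images K \<longleftrightarrow> (\<forall>B\<in>K. \<forall>C\<in>SubAlg. morphic_image B C \<longrightarrow> C \<in> K)"

definition closed_good_products :: "'u subord set \<Rightarrow> bool" where
  "closed_good_products K \<longleftrightarrow>
     (\<forall>(J :: 'u set) A. small TYPE('u) J \<longrightarrow> (\<forall>j\<in>J. A j \<in> K) \<longrightarrow> good_family J A \<longrightarrow>
        small TYPE('u) (carrier (prod_alg J A)) \<longrightarrow> belongs (prod_alg J A) K)"

definition closed_modalisation :: "'u subord set \<Rightarrow> bool" where
  "closed_modalisation K \<longleftrightarrow> (\<forall>B\<in>K. belongs (modalisation B) K)"

definition reflects_modalisation :: "'u subord set \<Rightarrow> bool" where
  "reflects_modalisation K \<longleftrightarrow> (\<forall>B\<in>SubAlg. belongs (modalisation B) K \<longrightarrow> B \<in> K)"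

definition modalised_products_condition :: "'u subord set \<Rightarrow> bool" where
  "modalised_products_condition K \<longleftrightarrow>
     (\<forall>(I :: 'u set) B. small TYPE('u) I \<longrightarrow> (\<forall>i\<in>I. B i \<in> SubAlg) \<longrightarrow>
        small TYPE('u) (carrier (prod_alg I (\<lambda>i. modalisation (B i)))) \<longrightarrow>
        (belongs (prod_alg I (\<lambda>i. modalisation (B i))) K \<longleftrightarrow> (\<forall>i\<in>I. B i \<in> K)))"

end

theory Submission
  imports Defs "HOL-Library.Countable_Set"
begin

text \<open>
  A \<open>Sub\<close>-morphism \<open>B \<rightarrow> C\<close> dualises to a bounded morphism \<open>Ult C \<rightarrow> Ult B\<close>, and hence to a modal
  homomorphism between the power set algebras; this makes validity stable under subalgebras and
  morphic images. Every element of the modalisation of \<open>B\<close> is the value of a formula at elements of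
  \<open>B\<close>, so \<open>B\<close> validates all instances of a scheme iff the modal algebra \<open>B\<^sup>m\<close> validates the formula.
  On a modal algebra the canonical embedding is a modal homomorphism, so modalisation does nothing
  there, and every product of modal algebras is good.

  Conversely, a class closed as in condition 4 is recovered by Birkhoff's argument: if \<open>B\<close>
  validates the schemes of \<open>K\<close>, then \<open>B\<^sup>m\<close> is a quotient of a subalgebra of a product of modal algebras
  in \<open>K\<close>, one for each equation refuted in \<open>B\<^sup>m\<close>. Since the universe need not be regular, this
  product is small only because the factors can be taken countable.
\<close>

section \<open>Boolean algebras and their ultrafilters\<close>

text \<open>Members of a class live on \<open>'u\<close>, while modalisations and products live on
  other types, so the closure conditions are used through \<open>belongs\<close>. That this is
  invariant under isomorphism comes from closure under morphic images: an isomorphism is a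
  surjective \<open>Sub\<close>-morphism. One Zorn argument, separating a filter from a disjoint
  ideal by an ultrafilter, supplies every ultrafilter needed. It yields points related to a given
  \<open>x\<close> because \<open>dual_rel B x y\<close> says that \<open>y\<close> misses a certain
  ideal determined by \<open>x\<close>. In the Birkhoff argument no free algebra is built. The
  product is indexed by pairs of a formula and a valuation in the modalisation of \<open>B\<close>
  not giving it the value top. Each factor comes with a map \<open>h\<close> from elements to
  elements, so every element \<open>m\<close> determines a tuple; the quotient map sends the value
  of a formula at such tuples to its value at the original elements. It is well defined because
  equality of two values amounts to a biconditional having value top. A product of small sets may
  fail to be small over a singular cardinal; a product of countable sets over a small
  \<open>I\<close> embeds into the power set of \<open>I\<close> times the naturals, and a strong
  limit suffices for that.\<close>

definition ba_filter :: "('a, 'm) balg_scheme \<Rightarrow> 'a set \<Rightarrow> bool" where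
  "ba_filter B F \<longleftrightarrow> F \<subseteq> carrier B \<and> bone B \<in> F \<and> (\<forall>a\<in>F. \<forall>b\<in>F. meet B a b \<in> F) \<and>
     (\<forall>a\<in>F. \<forall>b\<in>carrier B. ble B a b \<longrightarrow> b \<in> F)"

text \<open>Neither filters nor ideals are required to be proper. Where properness matters, it comes
  from the two being disjoint.\<close>

definition ba_ideal :: "('a, 'm) balg_scheme \<Rightarrow> 'a set \<Rightarrow> bool" where
  "ba_ideal B I \<longleftrightarrow> I \<subseteq> carrier B \<and> bzero B \<in> I \<and> (\<forall>a\<in>I. \<forall>b\<in>I. join B a b \<in> I) \<and>
     (\<forall>a\<in>carrier B. \<forall>b\<in>I. ble B a b \<longrightarrow> a \<in> I)"

section \<open>Lattice order derived from the Boolean equations\<close>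

context
  fixes B :: "('a, 'm) balg_scheme"
  assumes B: "boolean_alg B"
begin

lemma ba_closed [simp, intro]:
  "bzero B \<in> carrier B" "bone B \<in> carrier B"
  "a \<in> carrier B \<Longrightarrow> neg B a \<in> carrier B"
  "a \<in> carrier B \<Longrightarrow> b \<in> carrier B \<Longrightarrow> meet B a b \<in> carrier B"
  "a \<in> carrier B \<Longrightarrow> b \<in> carrier B \<Longrightarrow> join B a b \<in> carrier B"
  using B unfolding boolean_alg_def boolean_subuniverse_def by auto

lemma ba_eqs:
  assumes "a \<in> carrier B" "b \<in> carrier B" "c \<in> carrier B"
  shows ba_meet_assoc: "meet B (meet B a b) c = meet B a (meet B b c)"
    and ba_join_assoc: "join B (join B a b) c = join B a (join B b c)"
    and ba_meet_join: "meet B a (join B b c) = join B (meet B a b) (meet B a c)"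
    and ba_join_meet: "join B a (meet B b c) = meet B (join B a b) (join B a c)"
    and ba_meet_comm: "meet B a b = meet B b a"
    and ba_join_comm: "join B a b = join B b a"
  using B assms unfolding boolean_alg_def by blast+

lemma ba_units [simp]:
  assumes "a \<in> carrier B"
  shows "meet B a (bone B) = a" "join B a (bzero B) = a"
    "meet B a (neg B a) = bzero B" "join B a (neg B a) = bone B"
  using B assms unfolding boolean_alg_def by blast+

lemma ba_meet_idem [simp]: "meet B a a = a" if "a \<in> carrier B"
proof -
  have "a = meet B a (join B a (neg B a))" using that by simp
  also have "\<dots> = join B (meet B a a) (meet B a (neg B a))"
    using that by (intro ba_meet_join) auto
  finally show ?thesis using that by simp
qed

lemma ba_zero_join [simp]: "join B (bzero B) a = a" if "a \<in> carrier B"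
  using ba_join_comm[of "bzero B" a a] that by simp

lemma ba_one_meet [simp]: "meet B (bone B) a = a" if "a \<in> carrier B"
  using ba_meet_comm[of "bone B" a a] that by simp

lemma ba_meet_zero [simp]:
  assumes "a \<in> carrier B"
  shows "meet B a (bzero B) = bzero B" "meet B (bzero B) a = bzero B"
proof -
  have "meet B a (bzero B) = join B (meet B a (bzero B)) (meet B a (neg B a))"
    using assms by simp
  also have "\<dots> = meet B a (join B (bzero B) (neg B a))"
    using assms by (intro ba_meet_join[symmetric]) auto
  finally show "meet B a (bzero B) = bzero B" using assms by simp
  then show "meet B (bzero B) a = bzero B"
    using ba_meet_comm[of "bzero B" a a] assms by simp
qed

lemma ba_absorb [simp]: "meet B a (join B a b) = a"
  if "a \<in> carrier B" "b \<in> carrier B"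
proof -
  have "meet B a (join B a b) = meet B (join B a (bzero B)) (join B a b)" using that by simp
  also have "\<dots> = join B a (meet B (bzero B) b)"
    using that by (intro ba_join_meet[symmetric]) auto
  finally show ?thesis using that by simp
qed

lemma ble_refl [simp]: "a \<in> carrier B \<Longrightarrow> ble B a a"
  by (simp add: ble_def)

lemma ble_trans:
  "\<lbrakk>ble B a b; ble B b c; a \<in> carrier B; b \<in> carrier B; c \<in> carrier B\<rbrakk> \<Longrightarrow> ble B a c"
  unfolding ble_def by (metis ba_meet_assoc)

lemma ble_antisym: "\<lbrakk>ble B a b; ble B b a; a \<in> carrier B; b \<in> carrier B\<rbrakk> \<Longrightarrow> a = b"
  unfolding ble_def by (metis ba_meet_comm)

lemma ble_bounds [simp]:
  assumes "a \<in> carrier B"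
  shows "ble B (bzero B) a" "ble B a (bone B)"
  using assms by (simp_all add: ble_def)

lemma ble_meet:
  assumes "a \<in> carrier B" "b \<in> carrier B"
  shows "ble B (meet B a b) a" "ble B (meet B a b) b"
  unfolding ble_def using assms ba_meet_assoc ba_meet_comm
  by (metis ba_closed(4) ba_meet_idem)+

lemma ble_meetI:
  "\<lbrakk>ble B c a; ble B c b; a \<in> carrier B; b \<in> carrier B; c \<in> carrier B\<rbrakk> \<Longrightarrow> ble B c (meet B a b)"
  unfolding ble_def by (metis ba_meet_assoc)

lemma ble_meet_mono:
  "\<lbrakk>ble B a c; ble B b d; a \<in> carrier B; b \<in> carrier B; c \<in> carrier B; d \<in> carrier B\<rbrakk>
    \<Longrightarrow> ble B (meet B a b) (meet B c d)"
  by (meson ba_closed(4) ble_meet ble_meetI ble_trans)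

lemma ble_join:
  assumes "a \<in> carrier B" "b \<in> carrier B"
  shows "ble B a (join B a b)" "ble B b (join B a b)"
  using assms ba_join_comm[of b a a] ba_absorb[of b a] by (simp_all add: ble_def)

lemma ble_joinI:
  assumes "ble B a c" "ble B b c" "a \<in> carrier B" "b \<in> carrier B" "c \<in> carrier B"
  shows "ble B (join B a b) c"
proof -
  have "meet B (join B a b) c = meet B c (join B a b)"
    using assms by (intro ba_meet_comm) auto
  also have "\<dots> = join B (meet B c a) (meet B c b)"
    using assms by (intro ba_meet_join) auto
  also have "\<dots> = join B a b"
    using assms unfolding ble_def by (metis ba_meet_comm)
  finally show ?thesis by (simp add: ble_def)
qed

lemma ble_iff_join: "a \<in> carrier B \<Longrightarrow> b \<in> carrier B \<Longrightarrow> ble B a b \<longleftrightarrow> join B a b = b"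
  by (metis ble_antisym ble_join ble_joinI ble_refl ba_closed(5))

section \<open>Ultrafilters and their separation properties\<close>

lemma UltD:
  assumes "x \<in> Ult B"
  shows "x \<subseteq> carrier B" "bone B \<in> x" "bzero B \<notin> x"
    "\<And>a b. a \<in> x \<Longrightarrow> b \<in> x \<Longrightarrow> meet B a b \<in> x"
    "\<And>a b. a \<in> x \<Longrightarrow> b \<in> carrier B \<Longrightarrow> ble B a b \<Longrightarrow> b \<in> x"
    "\<And>a. a \<in> carrier B \<Longrightarrow> a \<in> x \<or> neg B a \<in> x"
  using assms unfolding Ult_def by auto

lemma Ult_meet:
  assumes "x \<in> Ult B" "a \<in> carrier B" "b \<in> carrier B"
  shows "meet B a b \<in> x \<longleftrightarrow> a \<in> x \<and> b \<in> x"
  using UltD[OF assms(1)] assms(2,3) ble_meet by meson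

lemma Ult_neg:
  assumes "x \<in> Ult B" "a \<in> carrier B"
  shows "neg B a \<in> x \<longleftrightarrow> a \<notin> x"
  using UltD[OF assms(1)] assms(2) ba_units(3) by metis

lemma Ult_join:
  assumes x: "x \<in> Ult B" and ab: "a \<in> carrier B" "b \<in> carrier B"
  shows "join B a b \<in> x \<longleftrightarrow> a \<in> x \<or> b \<in> x"
proof
  assume j: "join B a b \<in> x"
  show "a \<in> x \<or> b \<in> x"
  proof (rule ccontr)
    assume "\<not> ?thesis"
    then have n: "neg B a \<in> x" "neg B b \<in> x" using Ult_neg[OF x] ab by auto
    have c: "meet B (neg B a) (join B a b) \<in> x" using UltD(4)[OF x] j n by blast
    have "meet B (neg B a) (join B a b) = join B (meet B (neg B a) a) (meet B (neg B a) b)"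
      using ab by (intro ba_meet_join) auto
    also have "meet B (neg B a) a = bzero B"
      using ab ba_meet_comm[of a "neg B a" a] by simp
    also have "join B (bzero B) (meet B (neg B a) b) = meet B (neg B a) b" using ab by simp
    finally have "b \<in> x" using c ab Ult_meet[OF x, of "neg B a" b] by simp
    then show False using n Ult_neg[OF x] ab by auto
  qed
qed (use UltD(5)[OF x] ab ble_join in auto)

text \<open>An element of \<open>y\<close> outside \<open>x\<close> would have its complement in
  \<open>x\<close>, hence in \<open>y\<close>. Equalities of ultrafilters thus reduce to one
  inclusion.\<close>

lemma Ult_maximal: "x \<in> Ult B \<Longrightarrow> y \<in> Ult B \<Longrightarrow> x \<subseteq> y \<Longrightarrow> x = y"
  using Ult_neg UltD(1) by (metis subsetD subsetI subset_antisym)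

text \<open>The set is the filter generated by \<open>F\<close> and \<open>a\<close>; it is the
  enlargement against which a maximal filter is tested.\<close>

lemma ba_filter_extend:
  assumes F: "ba_filter B F" and a: "a \<in> carrier B"
  shows "ba_filter B {c \<in> carrier B. \<exists>b\<in>F. ble B (meet B b a) c}"
    and "F \<subseteq> {c \<in> carrier B. \<exists>b\<in>F. ble B (meet B b a) c}"
    and "a \<in> {c \<in> carrier B. \<exists>b\<in>F. ble B (meet B b a) c}"
proof -
  let ?G = "{c \<in> carrier B. \<exists>b\<in>F. ble B (meet B b a) c}"
  have sub: "F \<subseteq> carrier B" and one: "bone B \<in> F"
    and up: "\<And>a b. a \<in> F \<Longrightarrow> b \<in> carrier B \<Longrightarrow> ble B a b \<Longrightarrow> b \<in> F"
    and mt: "\<And>a b. a \<in> F \<Longrightarrow> b \<in> F \<Longrightarrow> meet B a b \<in> F"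
    using F unfolding ba_filter_def by auto
  show "F \<subseteq> ?G" using sub a ble_meet(1) by blast
  show "a \<in> ?G" using one a by (auto intro!: bexI[of _ "bone B"])
  show "ba_filter B ?G"
    unfolding ba_filter_def
  proof (intro conjI ballI impI)
    show "?G \<subseteq> carrier B" by auto
    show "bone B \<in> ?G" using one a by (auto intro!: bexI[of _ "bone B"])
  next
    fix c d assume "c \<in> ?G" "d \<in> ?G"
    then obtain b b' where cd: "c \<in> carrier B" "d \<in> carrier B" and b: "b \<in> F" "b' \<in> F"
      "ble B (meet B b a) c" "ble B (meet B b' a) d" by auto
    have bc: "b \<in> carrier B" "b' \<in> carrier B" using b sub by auto
    have "ble B (meet B (meet B b b') a) (meet B b a)" "ble B (meet B (meet B b b') a) (meet B b' a)"
      using bc a by (auto intro!: ble_meet_mono ble_meet)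
    then have "ble B (meet B (meet B b b') a) (meet B c d)"
      using bc a b cd by (meson ba_closed(4) ble_meetI ble_trans)
    then show "meet B c d \<in> ?G" using mt[OF b(1,2)] cd by auto
  next
    fix c d assume c: "c \<in> ?G" and d: "d \<in> carrier B" "ble B c d"
    then obtain b where b: "c \<in> carrier B" "b \<in> F" "ble B (meet B b a) c" by auto
    have "ble B (meet B b a) d" using b d sub a by (meson ba_closed(4) ble_trans subsetD)
    then show "d \<in> ?G" using b d by auto
  qed
qed

text \<open>Zorn gives a filter \<open>x\<close> maximal among those that contain \<open>F\<close>
  and avoid \<open>I\<close>. If it contained neither \<open>a\<close> nor its complement, adding
  either one would hit \<open>I\<close>, and the two witnesses together would put an element of
  \<open>x\<close> into \<open>I\<close>.\<close>

lemma ultrafilter_separation: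
  assumes F: "ba_filter B F" and I: "ba_ideal B I" and FI: "F \<inter> I = {}"
  obtains x where "x \<in> Ult B" "F \<subseteq> x" "x \<inter> I = {}"
proof -
  let ?A = "{G. ba_filter B G \<and> F \<subseteq> G \<and> G \<inter> I = {}}"
  have "\<exists>M\<in>?A. \<forall>X\<in>?A. M \<subseteq> X \<longrightarrow> X = M"
  proof (rule subset_Zorn)
    fix C assume C: "subset.chain ?A C"
    then have CA: "C \<subseteq> ?A" by (simp add: subset.chain_def)
    show "\<exists>U\<in>?A. \<forall>X\<in>C. X \<subseteq> U"
    proof (cases "C = {}")
      case True then show ?thesis using F FI by auto
    next
      case False
      have "ba_filter B (\<Union>C)"
        unfolding ba_filter_def
      proof (intro conjI ballI impI)
        show "\<Union>C \<subseteq> carrier B" "bone B \<in> \<Union>C" using CA False by (auto simp: ba_filter_def)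
      next
        fix a b assume "a \<in> \<Union>C" "b \<in> \<Union>C"
        then obtain X Y where XY: "a \<in> X" "b \<in> Y" "X \<in> C" "Y \<in> C" by auto
        then have "X \<subseteq> Y \<or> Y \<subseteq> X" using C by (auto simp: subset_chain_def)
        then obtain Z where "Z \<in> C" "a \<in> Z" "b \<in> Z" using XY by auto
        then show "meet B a b \<in> \<Union>C" using CA unfolding ba_filter_def by blast
      next
        fix a b assume "a \<in> \<Union>C" "b \<in> carrier B" "ble B a b"
        then show "b \<in> \<Union>C" using CA unfolding ba_filter_def by blast
      qed
      moreover have "F \<subseteq> \<Union>C" "\<Union>C \<inter> I = {}" using False CA by auto
      ultimately show ?thesis by blast
    qed
  qed
  then obtain x where xA: "x \<in> ?A" and maxA: "\<forall>X\<in>?A. x \<subseteq> X \<longrightarrow> X = x"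
    by (elim bexE)
  then have x: "ba_filter B x" "F \<subseteq> x" "x \<inter> I = {}" by simp_all
  have max: "X = x" if "ba_filter B X" "x \<subseteq> X" "X \<inter> I = {}" for X
    using maxA that x(2) by simp
  have sub: "x \<subseteq> carrier B" and one: "bone B \<in> x"
    and up: "\<And>a b. a \<in> x \<Longrightarrow> b \<in> carrier B \<Longrightarrow> ble B a b \<Longrightarrow> b \<in> x"
    and mt: "\<And>a b. a \<in> x \<Longrightarrow> b \<in> x \<Longrightarrow> meet B a b \<in> x"
    using x unfolding ba_filter_def by auto
  have zI: "bzero B \<in> I" and jI: "\<And>a b. a \<in> I \<Longrightarrow> b \<in> I \<Longrightarrow> join B a b \<in> I"
    and dI: "\<And>a b. a \<in> carrier B \<Longrightarrow> b \<in> I \<Longrightarrow> ble B a b \<Longrightarrow> a \<in> I" and Isub: "I \<subseteq> carrier B"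
    using I unfolding ba_ideal_def by auto
  \<comment> \<open>By maximality the filter generated by \<open>x\<close> and \<open>a\<close>
    meets \<open>I\<close>; as \<open>I\<close> is downward closed, it then contains one of the
    generating meets.\<close>
  have key: "\<exists>b\<in>x. meet B b a \<in> I" if a: "a \<in> carrier B" "a \<notin> x" for a
  proof (rule ccontr)
    assume *: "\<not> ?thesis"
    have "{c \<in> carrier B. \<exists>b\<in>x. ble B (meet B b a) c} \<inter> I = {}"
    proof (rule ccontr)
      assume "\<not> ?thesis"
      then obtain c b where "c \<in> I" "b \<in> x" "ble B (meet B b a) c" by blast
      then have "meet B b a \<in> I" using dI[of "meet B b a" c] sub a by auto
      then show False using * \<open>b \<in> x\<close> by blast
    qed
    then have "{c \<in> carrier B. \<exists>b\<in>x. ble B (meet B b a) c} = x"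
      using max[OF ba_filter_extend(1,2)[OF x(1) a(1)]] by blast
    then show False using ba_filter_extend(3)[OF x(1) a(1)] a by simp
  qed
  have "a \<in> x \<or> neg B a \<in> x" if a: "a \<in> carrier B" for a
  proof (rule ccontr)
    assume "\<not> ?thesis"
    then obtain b b' where b: "b \<in> x" "meet B b a \<in> I" "b' \<in> x" "meet B b' (neg B a) \<in> I"
      using key[of a] key[of "neg B a"] a by auto
    \<comment> \<open>\<open>?c\<close> is the join of its parts below \<open>a\<close> and below
      the complement of \<open>a\<close>, and both parts lie in \<open>I\<close>.\<close>
    let ?c = "meet B b b'"
    have bc: "b \<in> carrier B" "b' \<in> carrier B" using b sub by auto
    have "ble B (meet B ?c a) (meet B b a)" "ble B (meet B ?c (neg B a)) (meet B b' (neg B a))"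
      using bc a by (auto intro!: ble_meet_mono ble_meet)
    then have "join B (meet B ?c a) (meet B ?c (neg B a)) \<in> I"
      using dI[of "meet B ?c a"] dI[of "meet B ?c (neg B a)"] b(2,4) bc a
      by (intro jI) simp_all
    moreover have "join B (meet B ?c a) (meet B ?c (neg B a)) = meet B ?c (join B a (neg B a))"
      using bc a by (intro ba_meet_join[symmetric]) auto
    ultimately have "?c \<in> I" using bc a by simp
    then show False using mt[OF b(1,3)] x(3) by blast
  qed
  moreover have "bzero B \<notin> x" using zI x(3) by blast
  ultimately have "x \<in> Ult B" unfolding Ult_def using sub one up mt by blast
  then show thesis using that x by blast
qed

lemma ba_filter_up: "a \<in> carrier B \<Longrightarrow> ba_filter B {c \<in> carrier B. ble B a c}"
  unfolding ba_filter_def by (auto intro: ble_meetI ble_trans)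

lemma ba_ideal_down: "a \<in> carrier B \<Longrightarrow> ba_ideal B {c \<in> carrier B. ble B c a}"
  unfolding ba_ideal_def by (auto intro: ble_joinI ble_trans)

lemma ba_filter_Ult: "x \<in> Ult B \<Longrightarrow> ba_filter B x"
  unfolding ba_filter_def Ult_def by auto

lemma ultrafilter_exists:
  assumes "a \<in> carrier B" "b \<in> carrier B" "\<not> ble B a b"
  obtains x where "x \<in> Ult B" "a \<in> x" "b \<notin> x"
proof -
  have "{c \<in> carrier B. ble B a c} \<inter> {c \<in> carrier B. ble B c b} = {}"
    using assms by (auto intro: ble_trans)
  then obtain x where "x \<in> Ult B" "{c \<in> carrier B. ble B a c} \<subseteq> x"
      "x \<inter> {c \<in> carrier B. ble B c b} = {}"
    by (rule ultrafilter_separation[OF ba_filter_up[OF assms(1)] ba_ideal_down[OF assms(2)]])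
  then have "a \<in> x" "b \<notin> x" using assms by (auto dest: subsetD)
  then show thesis using that \<open>x \<in> Ult B\<close> by blast
qed

lemma ble_iff_Ult:
  "a \<in> carrier B \<Longrightarrow> b \<in> carrier B \<Longrightarrow> ble B a b \<longleftrightarrow> (\<forall>x\<in>Ult B. a \<in> x \<longrightarrow> b \<in> x)"
  by (metis ultrafilter_exists UltD(5))

lemma ba_eq_iff_Ult:
  "a \<in> carrier B \<Longrightarrow> b \<in> carrier B \<Longrightarrow> a = b \<longleftrightarrow> (\<forall>x\<in>Ult B. a \<in> x \<longleftrightarrow> b \<in> x)"
  by (metis ble_iff_Ult ble_antisym)

lemma ba_iff_one:
  assumes "a \<in> carrier B" "b \<in> carrier B"
  shows "meet B (join B (neg B a) b) (join B (neg B b) a) = bone B \<longleftrightarrow> a = b"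
  using assms by (auto simp: ba_eq_iff_Ult Ult_meet Ult_join Ult_neg UltD(2))

end

section \<open>Modal algebras and interpretations of formulas\<close>

definition modal_alg :: "'a modal \<Rightarrow> bool" where
  "modal_alg M \<longleftrightarrow> boolean_alg M \<and> (\<forall>a\<in>carrier M. dia M a \<in> carrier M) \<and>
     dia M (bzero M) = bzero M \<and>
     (\<forall>a\<in>carrier M. \<forall>b\<in>carrier M. dia M (join M a b) = join M (dia M a) (dia M b))"

definition modal_hom :: "'a modal \<Rightarrow> 'b modal \<Rightarrow> ('a \<Rightarrow> 'b) \<Rightarrow> bool" where
  "modal_hom M N f \<longleftrightarrow> boolean_hom M N f \<and> (\<forall>a\<in>carrier M. f (dia M a) = dia N (f a))"

definition mvalid :: "'a modal \<Rightarrow> fm \<Rightarrow> bool" where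
  "mvalid M \<phi> \<longleftrightarrow> (\<forall>v. range v \<subseteq> carrier M \<longrightarrow> interp M v \<phi> = bone M)"

lemma sub_of_modal_simps [simp]:
  "carrier (sub_of_modal M) = carrier M" "meet (sub_of_modal M) = meet M"
  "join (sub_of_modal M) = join M" "neg (sub_of_modal M) = neg M"
  "bzero (sub_of_modal M) = bzero M" "bone (sub_of_modal M) = bone M"
  "prec (sub_of_modal M) = (\<lambda>a b. ble M (dia M a) b)" "ble (sub_of_modal M) = ble M"
  "Ult (sub_of_modal M) = Ult M"
  by (auto simp: sub_of_modal_def ble_def fun_eq_iff Ult_def)

lemma sub_of_modal_carrier_update:
  "(sub_of_modal M)\<lparr>carrier := S\<rparr> = sub_of_modal (M\<lparr>carrier := S\<rparr>)"
  by (simp add: sub_of_modal_def ble_def fun_eq_iff)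

lemma boolean_alg_sub_of_modal [simp]: "boolean_alg (sub_of_modal M) \<longleftrightarrow> boolean_alg M"
  by (simp only: sub_of_modal_simps boolean_alg_def boolean_subuniverse_def)

lemma boolean_hom_sub_of_modal [simp]:
  "boolean_hom (sub_of_modal M) (sub_of_modal N) f \<longleftrightarrow> boolean_hom M N f"
  by (simp add: boolean_hom_def)

lemma subordination_alg_boolean: "subordination_alg B \<Longrightarrow> boolean_alg B"
  by (simp add: subordination_alg_def)

lemma modal_alg_boolean: "modal_alg M \<Longrightarrow> boolean_alg M"
  unfolding modal_alg_def by blast

lemma boolean_hom_ble:
  "boolean_hom B C f \<Longrightarrow> a \<in> carrier B \<Longrightarrow> b \<in> carrier B \<Longrightarrow> ble B a b \<Longrightarrow> ble C (f a) (f b)"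
  unfolding boolean_hom_def ble_def by metis

lemma modal_alg_mono:
  "\<lbrakk>modal_alg M; ble M a b; a \<in> carrier M; b \<in> carrier M\<rbrakk> \<Longrightarrow> ble M (dia M a) (dia M b)"
  unfolding modal_alg_def by (metis ble_iff_join)

lemma subordination_alg_sub_of_modal:
  assumes M: "modal_alg M"
  shows "subordination_alg (sub_of_modal M)"
proof -
  have B: "boolean_alg M" and d: "\<And>a. a \<in> carrier M \<Longrightarrow> dia M a \<in> carrier M"
    and z: "dia M (bzero M) = bzero M"
    and j: "\<And>a b. a \<in> carrier M \<Longrightarrow> b \<in> carrier M \<Longrightarrow> dia M (join M a b) = join M (dia M a) (dia M b)"
    using M unfolding modal_alg_def by auto
  have tr: "ble M (dia M a) e"
    if "a \<in> carrier M" "b \<in> carrier M" "c \<in> carrier M" "e \<in> carrier M"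
      "ble M a b" "ble M (dia M b) c" "ble M c e" for a b c e
    using that modal_alg_mono[OF M, of a b] d ble_trans[OF B, of "dia M a" "dia M b" c]
      ble_trans[OF B, of "dia M a" c e] by simp
  show ?thesis
    unfolding subordination_alg_def sub_of_modal_simps boolean_alg_sub_of_modal
  proof (intro conjI ballI impI)
    fix a b c e assume "a \<in> carrier M" "b \<in> carrier M" "c \<in> carrier M" "e \<in> carrier M"
      "ble M a b" "ble M (dia M b) c" "ble M c e"
    then show "ble M (dia M a) e" by (rule tr)
  qed (use B d z in \<open>simp_all add: j ble_joinI[OF B] ble_meetI[OF B]\<close>)
qed

text \<open>In the back condition \<open>dia M a\<close> is the witness: it is the least element to
  which \<open>a\<close> is subordinate, and \<open>f\<close> commutes with the diamond.\<close>

lemma modal_hom_sub_morphism: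
  assumes M: "modal_alg M" and N: "modal_alg N" and f: "modal_hom M N f"
  shows "sub_morphism (sub_of_modal M) (sub_of_modal N) f"
proof -
  have BM: "boolean_alg M" and d: "\<And>a. a \<in> carrier M \<Longrightarrow> dia M a \<in> carrier M"
    using M unfolding modal_alg_def by auto
  have h: "boolean_hom M N f" and fd: "\<And>a. a \<in> carrier M \<Longrightarrow> f (dia M a) = dia N (f a)"
    using f unfolding modal_hom_def by auto
  show ?thesis
    unfolding sub_morphism_def
  proof (intro conjI ballI impI)
    fix a b assume "a \<in> carrier (sub_of_modal M)" "b \<in> carrier (sub_of_modal M)"
      "prec (sub_of_modal M) a b"
    then show "prec (sub_of_modal N) (f a) (f b)"
      using boolean_hom_ble[OF h, of "dia M a" b] d fd by simp
  next
    fix a c assume "a \<in> carrier (sub_of_modal M)" "c \<in> carrier (sub_of_modal N)"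
      "prec (sub_of_modal N) (f a) c"
    then show "\<exists>b\<in>carrier (sub_of_modal M). prec (sub_of_modal M) a b \<and> ble (sub_of_modal N) (f b) c"
      using d fd BM by (intro bexI[of _ "dia M a"]) simp_all
  qed (use h in simp)
qed

section \<open>Subalgebras and the values of formulas\<close>

lemma carrier_update_simps:
  "carrier (B\<lparr>carrier := S\<rparr>) = S" "meet (B\<lparr>carrier := S\<rparr>) = meet B"
  "join (B\<lparr>carrier := S\<rparr>) = join B" "neg (B\<lparr>carrier := S\<rparr>) = neg B"
  "bzero (B\<lparr>carrier := S\<rparr>) = bzero B" "bone (B\<lparr>carrier := S\<rparr>) = bone B"
  "ble (B\<lparr>carrier := S\<rparr>) = ble B"
  by (simp_all add: ble_def fun_eq_iff)

lemma boolean_alg_carrier_update: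
  assumes B: "boolean_alg B" and S: "boolean_subuniverse B S"
  shows "boolean_alg (B\<lparr>carrier := S\<rparr>)"
proof -
  have sub: "\<And>a. a \<in> S \<Longrightarrow> a \<in> carrier B"
    using S unfolding boolean_subuniverse_def by auto
  show ?thesis
    unfolding boolean_alg_def carrier_update_simps
  proof (intro conjI ballI)
    show "boolean_subuniverse (B\<lparr>carrier := S\<rparr>) S"
      using S unfolding boolean_subuniverse_def carrier_update_simps by blast
  qed (rule ba_eqs[OF B] ba_units[OF B]; rule sub; assumption)+
qed

lemma modal_alg_carrier_update:
  assumes "modal_alg M" "modal_subuniverse M S"
  shows "modal_alg (M\<lparr>carrier := S\<rparr>)"
proof -
  have "S \<subseteq> carrier M"
    using assms unfolding modal_subuniverse_def boolean_subuniverse_def by blast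
  then show ?thesis
    using assms boolean_alg_carrier_update[of M S]
    unfolding modal_alg_def modal_subuniverse_def by (auto simp: subset_iff)
qed

lemma interp_carrier_update [simp]: "interp (M\<lparr>carrier := S\<rparr>) v \<phi> = interp M v \<phi>"
  by (induction \<phi>) simp_all

lemma interp_subst: "interp M v (subst \<sigma> \<phi>) = interp M (\<lambda>p. interp M v (\<sigma> p)) \<phi>"
  by (induction \<phi>) simp_all

lemma subst_Var [simp]: "subst Var \<phi> = \<phi>"
  by (induction \<phi>) simp_all

lemma interp_in_subuniverse:
  assumes "modal_subuniverse M S" "range v \<subseteq> S"
  shows "interp M v \<phi> \<in> S"
  using assms by (induction \<phi>) (auto simp: modal_subuniverse_def boolean_subuniverse_def)

lemma modal_subuniverse_carrier: "modal_alg M \<Longrightarrow> modal_subuniverse M (carrier M)"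
  unfolding modal_alg_def modal_subuniverse_def boolean_alg_def by auto

lemma interp_closed: "modal_alg M \<Longrightarrow> range v \<subseteq> carrier M \<Longrightarrow> interp M v \<phi> \<in> carrier M"
  by (simp add: interp_in_subuniverse modal_subuniverse_carrier)

lemma modal_hom_interp:
  assumes M: "modal_alg M" and f: "modal_hom M N f" and v: "range v \<subseteq> carrier M"
  shows "f (interp M v \<phi>) = interp N (f \<circ> v) \<phi>"
  using f by (induction \<phi>)
    (auto simp: modal_hom_def boolean_hom_def interp_closed[OF M v])

lemma modal_subuniverse_range_interp:
  assumes "modal_alg M" "range v \<subseteq> carrier M"
  shows "modal_subuniverse M (range (interp M v))"
  unfolding modal_subuniverse_def boolean_subuniverse_def
proof (intro conjI ballI)
  show "range (interp M v) \<subseteq> carrier M" using interp_closed[OF assms] by auto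
  show "bzero M \<in> range (interp M v)" by (rule range_eqI[of _ _ Bot]) simp
  \<comment> \<open>Formulas have no constant for top, so it is obtained as an instance of excluded
    middle.\<close>
  show "bone M \<in> range (interp M v)"
    using assms interp_closed[OF assms, of Bot]
    by (intro range_eqI[of _ _ "Disj Bot (Neg Bot)"]) (simp add: modal_alg_def)
next
  fix a assume "a \<in> range (interp M v)"
  then obtain \<phi> where a: "a = interp M v \<phi>" by auto
  show "neg M a \<in> range (interp M v)" by (rule range_eqI[of _ _ "Neg \<phi>"]) (simp add: a)
  show "dia M a \<in> range (interp M v)" by (rule range_eqI[of _ _ "Dia \<phi>"]) (simp add: a)
next
  fix a b assume "a \<in> range (interp M v)" "b \<in> range (interp M v)"
  then obtain \<phi> \<psi> where a: "a = interp M v \<phi>" "b = interp M v \<psi>" by auto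
  show "meet M a b \<in> range (interp M v)" by (rule range_eqI[of _ _ "Conj \<phi> \<psi>"]) (simp add: a)
  show "join M a b \<in> range (interp M v)" by (rule range_eqI[of _ _ "Disj \<phi> \<psi>"]) (simp add: a)
qed

text \<open>The subalgebra generated by \<open>X\<close>, described by terms instead of as an
  intersection. Valuations are total, so for empty \<open>X\<close> this set is empty and not a
  subalgebra; hence the non-emptiness assumptions below.\<close>

definition generated :: "'a modal \<Rightarrow> 'a set \<Rightarrow> 'a set" where
  "generated M X = {interp M v \<phi> | v \<phi>. range v \<subseteq> X}"

text \<open>Two valuations are merged by giving the even variables to one and the odd ones to the other.\<close>

lemma merge_valuations:
  fixes g h :: "nat \<Rightarrow> 'b"
  obtains k :: "nat \<Rightarrow> 'b" and \<sigma> \<tau> where "range k \<subseteq> range g \<union> range h"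
    "\<forall>(M :: 'a modal) e \<phi>. interp M (\<lambda>p. e (k p)) (subst \<sigma> \<phi>) = interp M (\<lambda>p. e (g p)) \<phi>"
    "\<forall>(M :: 'a modal) e \<phi>. interp M (\<lambda>p. e (k p)) (subst \<tau> \<phi>) = interp M (\<lambda>p. e (h p)) \<phi>"
    "\<forall>(N :: 'b modal) \<phi>. interp N k (subst \<sigma> \<phi>) = interp N g \<phi>"
    "\<forall>(N :: 'b modal) \<phi>. interp N k (subst \<tau> \<phi>) = interp N h \<phi>"
proof -
  let ?k = "\<lambda>n. if even n then g (n div 2) else h (n div 2)"
  show thesis
    by (rule that[of ?k "\<lambda>p. Var (2 * p)" "\<lambda>p. Var (2 * p + 1)"])
      (auto simp: interp_subst)
qed

text \<open>Two elements may come from different valuations. After merging these, both lie in the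
  range of one \<open>interp M v\<close>, which is already known to be a subalgebra.\<close>

lemma modal_subuniverse_generated:
  assumes M: "modal_alg M" and X: "X \<subseteq> carrier M" "X \<noteq> {}"
  shows "modal_subuniverse M (generated M X)"
proof -
  have *: "\<exists>v. range v \<subseteq> X \<and> a \<in> range (interp M v) \<and> b \<in> range (interp M v)"
    if "a \<in> generated M X" "b \<in> generated M X" for a b
  proof -
    obtain g h \<phi> \<psi> where g: "range g \<subseteq> X" "range h \<subseteq> X"
      and ab: "a = interp M g \<phi>" "b = interp M h \<psi>"
      using \<open>a \<in> _\<close> \<open>b \<in> _\<close> unfolding generated_def by auto
    obtain k \<sigma> \<tau> where k: "range k \<subseteq> range g \<union> range h"
      "interp M k (subst \<sigma> \<phi>) = interp M g \<phi>" "interp M k (subst \<tau> \<psi>) = interp M h \<psi>"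
      using merge_valuations[of g h] by metis
    then show ?thesis
      using g ab by (intro exI[of _ k]) (auto intro: range_eqI[OF sym])
  qed
  have **: "range (interp M v) \<subseteq> generated M X" if "range v \<subseteq> X" for v
    using that unfolding generated_def by auto
  have sub: "modal_subuniverse M (range (interp M v))" if "range v \<subseteq> X" for v
    using modal_subuniverse_range_interp[OF M] that X by auto
  obtain x where "x \<in> X" using X by auto
  then have x: "range (\<lambda>_ :: nat. x) \<subseteq> X" by auto
  show ?thesis
    unfolding modal_subuniverse_def boolean_subuniverse_def
  proof (intro conjI ballI)
    show "generated M X \<subseteq> carrier M"
      unfolding generated_def using interp_closed[OF M] X by blast
    show "bzero M \<in> generated M X" "bone M \<in> generated M X"
      using sub[OF x] **[OF x] unfolding modal_subuniverse_def boolean_subuniverse_def by auto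
  next
    fix a assume a: "a \<in> generated M X"
    obtain v where v: "range v \<subseteq> X" "a \<in> range (interp M v)" using *[OF a a] by blast
    then have "neg M a \<in> range (interp M v)" "dia M a \<in> range (interp M v)"
      using sub[OF v(1)] unfolding modal_subuniverse_def boolean_subuniverse_def by blast+
    then show "neg M a \<in> generated M X" "dia M a \<in> generated M X"
      using **[OF v(1)] by blast+
  next
    fix a b assume a: "a \<in> generated M X" "b \<in> generated M X"
    obtain v where v: "range v \<subseteq> X" "a \<in> range (interp M v)" "b \<in> range (interp M v)"
      using *[OF a] by blast
    then have "meet M a b \<in> range (interp M v)" "join M a b \<in> range (interp M v)"
      using sub[OF v(1)] unfolding modal_subuniverse_def boolean_subuniverse_def by blast+
    then show "meet M a b \<in> generated M X" "join M a b \<in> generated M X"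
      using **[OF v(1)] by blast+
  qed
qed

lemma generated_hull:
  assumes M: "modal_alg M" and X: "X \<subseteq> carrier M" "X \<noteq> {}"
  shows "modal_subuniverse M hull X = generated M X"
proof (rule hull_unique)
  show "X \<subseteq> generated M X"
  proof
    fix x assume "x \<in> X"
    then show "x \<in> generated M X"
      unfolding generated_def by (intro CollectI exI[of _ "\<lambda>_. x"] exI[of _ "Var 0"]) auto
  qed
  show "modal_subuniverse M (generated M X)"
    by (rule modal_subuniverse_generated[OF assms])
next
  fix T assume T: "X \<subseteq> T" "modal_subuniverse M T"
  show "generated M X \<subseteq> T"
    unfolding generated_def using interp_in_subuniverse[OF T(2) order_trans[OF _ T(1)]] by auto
qed

text \<open>Turns an equation into a condition on a single formula, so that separating formulas from
  top is enough to separate elements.\<close>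

lemma interp_Iff_one:
  assumes "modal_alg M" "range v \<subseteq> carrier M"
  shows "interp M v (Iff \<phi> \<psi>) = bone M \<longleftrightarrow> interp M v \<phi> = interp M v \<psi>"
  using ba_iff_one[OF modal_alg_boolean[OF assms(1)] interp_closed[OF assms] interp_closed[OF assms]]
  by simp

section \<open>Duality\<close>

lemma delta_simps [simp]:
  "carrier (delta B) = Pow (Ult B)" "meet (delta B) = (\<inter>)" "join (delta B) = (\<union>)"
  "neg (delta B) = (\<lambda>E. Ult B - E)" "bzero (delta B) = {}" "bone (delta B) = Ult B"
  "dia (delta B) = (\<lambda>E. {x \<in> Ult B. \<exists>y\<in>E. dual_rel B x y})"
  by (simp_all add: delta_def)

lemma modal_alg_delta: "modal_alg (delta B)"
  unfolding modal_alg_def boolean_alg_def boolean_subuniverse_def by auto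

text \<open>At a fixed point \<open>x\<close> the connectives act truth-functionally once variables
  and diamond formulas count as atoms. This gives the validity of tautologies.\<close>

lemma in_interp_delta_iff_ptrue:
  assumes "x \<in> Ult B" "range u \<subseteq> Pow (Ult B)"
  shows "x \<in> interp (delta B) u \<phi> \<longleftrightarrow> ptrue (\<lambda>\<psi>. x \<in> interp (delta B) u \<psi>) \<phi>"
  using assms by (induction \<phi>) auto

lemma ult_rep_boolean_hom:
  assumes "boolean_alg B"
  shows "boolean_hom B (delta B) (ult_rep B)"
  using Ult_meet[OF assms] Ult_join[OF assms] Ult_neg[OF assms] UltD(2,3)[OF assms]
  unfolding boolean_hom_def ult_rep_def by (auto simp: ba_closed[OF assms])

lemma ult_rep_range: "ult_rep B ` carrier B \<subseteq> Pow (Ult B)"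
  by (auto simp: ult_rep_def)

lemma ult_rep_comp_range: "range (ult_rep B \<circ> v) \<subseteq> Pow (Ult B)"
  by (auto simp: ult_rep_def)

lemma ult_rep_inj: "boolean_alg B \<Longrightarrow> inj_on (ult_rep B) (carrier B)"
  by (rule inj_onI) (auto simp: ult_rep_def ba_eq_iff_Ult set_eq_iff)

lemma valid_alt:
  "valid B \<phi> \<longleftrightarrow> (\<forall>v. range v \<subseteq> carrier B \<longrightarrow> interp (delta B) (ult_rep B \<circ> v) \<phi> = Ult B)"
  by (simp add: valid_def comp_def)

lemma prec_mono:
  assumes "subordination_alg B" "ble B a b" "prec B b c" "ble B c d"
    "a \<in> carrier B" "b \<in> carrier B" "c \<in> carrier B" "d \<in> carrier B"
  shows "prec B a d"
  using assms unfolding subordination_alg_def by blast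

text \<open>By \<open>dual_rel_iff_disjoint\<close>, \<open>dual_rel B x y\<close> holds exactly
  when \<open>y\<close> misses this ideal. To find such a \<open>y\<close> extending a given filter,
  it thus suffices that the filter misses the ideal.\<close>

lemma ba_ideal_not_prec:
  assumes B: "subordination_alg B" and x: "x \<in> Ult B"
  shows "ba_ideal B {c \<in> carrier B. \<exists>d\<in>carrier B. prec B c d \<and> d \<notin> x}" (is "ba_ideal B ?I")
proof -
  note BA = subordination_alg_boolean[OF B]
  show ?thesis
    unfolding ba_ideal_def
  proof (intro conjI ballI impI)
    show "?I \<subseteq> carrier B" by auto
    show "bzero B \<in> ?I"
      using B UltD(3)[OF BA x] ba_closed(1)[OF BA] unfolding subordination_alg_def by blast
  next
    fix a b assume "a \<in> ?I" "b \<in> ?I"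
    then obtain c d where *: "a \<in> carrier B" "b \<in> carrier B" "c \<in> carrier B" "d \<in> carrier B"
      "prec B a c" "prec B b d" "c \<notin> x" "d \<notin> x" by auto
    let ?e = "join B c d"
    have e: "?e \<in> carrier B" using * BA by (simp add: ba_closed)
    have "prec B a ?e" "prec B b ?e"
      using prec_mono[OF B _ *(5) ble_join(1)[OF BA]] prec_mono[OF B _ *(6) ble_join(2)[OF BA]]
        * e ble_refl[OF BA] by blast+
    then have "prec B (join B a b) ?e"
      using B * e unfolding subordination_alg_def by blast
    moreover have "?e \<notin> x" using Ult_join[OF BA x] * by blast
    ultimately show "join B a b \<in> ?I" using e * BA by (auto simp: ba_closed)
  next
    fix a b assume a: "a \<in> carrier B" "b \<in> ?I" "ble B a b"
    then obtain c where c: "b \<in> carrier B" "c \<in> carrier B" "prec B b c" "c \<notin> x" by auto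
    then have "prec B a c" using prec_mono[OF B a(3) c(3)] ble_refl[OF BA] a by blast
    then show "a \<in> ?I" using a c by blast
  qed
qed

lemma dual_rel_iff_disjoint:
  assumes "y \<subseteq> carrier B"
  shows "dual_rel B x y \<longleftrightarrow> y \<inter> {c \<in> carrier B. \<exists>d\<in>carrier B. prec B c d \<and> d \<notin> x} = {}"
  using assms unfolding dual_rel_def by auto

text \<open>The Jonsson-Tarski argument for a single element: if \<open>d\<close> is least among the
  elements to which \<open>a\<close> is subordinate and \<open>d\<close> is in \<open>x\<close>,
  then the principal filter of \<open>a\<close> misses the ideal of \<open>x\<close>, and separation
  yields a suitable \<open>y\<close>.\<close>

lemma dia_ult_rep:
  assumes B: "subordination_alg B" and a: "a \<in> carrier B" and d: "d \<in> carrier B"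
    and least: "\<And>b. b \<in> carrier B \<Longrightarrow> prec B a b \<longleftrightarrow> ble B d b"
  shows "dia (delta B) (ult_rep B a) = ult_rep B d"
proof -
  note BA = subordination_alg_boolean[OF B]
  have "prec B a d" using least d ble_refl[OF BA] by blast
  have "(\<exists>y\<in>Ult B. a \<in> y \<and> dual_rel B x y) \<longleftrightarrow> d \<in> x" if x: "x \<in> Ult B" for x
  proof
    assume "\<exists>y\<in>Ult B. a \<in> y \<and> dual_rel B x y"
    then show "d \<in> x" using \<open>prec B a d\<close> d unfolding dual_rel_def by auto
  next
    assume dx: "d \<in> x"
    let ?I = "{c \<in> carrier B. \<exists>d\<in>carrier B. prec B c d \<and> d \<notin> x}"
    have "{c \<in> carrier B. ble B a c} \<inter> ?I = {}"
    proof (rule ccontr)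
      assume "\<not> ?thesis"
      then obtain c e where c: "c \<in> carrier B" "e \<in> carrier B" "ble B a c" "prec B c e" "e \<notin> x"
        by blast
      then have "prec B a e" using prec_mono[OF B c(3,4) ble_refl[OF BA]] a by blast
      then show False using least c dx UltD(5)[OF BA x] by blast
    qed
    then obtain y where y: "y \<in> Ult B" "{c \<in> carrier B. ble B a c} \<subseteq> y" "y \<inter> ?I = {}"
      by (rule ultrafilter_separation[OF BA ba_filter_up[OF BA a] ba_ideal_not_prec[OF B x]])
    moreover have "a \<in> y" using y(2) a ble_refl[OF BA] by blast
    ultimately show "\<exists>y\<in>Ult B. a \<in> y \<and> dual_rel B x y"
      using dual_rel_iff_disjoint[OF UltD(1)[OF BA y(1)]] by blast
  qed
  then show ?thesis unfolding ult_rep_def by auto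
qed

section \<open>Duals of morphisms\<close>

definition ult_vimage :: "('a, 'm) balg_scheme \<Rightarrow> ('a \<Rightarrow> 'b) \<Rightarrow> 'b set \<Rightarrow> 'a set" where
  "ult_vimage B f y = {a \<in> carrier B. f a \<in> y}"

text \<open>Inverse image under \<open>ult_vimage B f\<close>, the dual point map from
  \<open>Ult C\<close> to \<open>Ult B\<close>. Points travel backwards, so sets of points travel in
  the direction of \<open>f\<close>.\<close>

definition dual_map :: "'a subord \<Rightarrow> 'b subord \<Rightarrow> ('a \<Rightarrow> 'b) \<Rightarrow> 'a set set \<Rightarrow> 'b set set" where
  "dual_map B C f E = {y \<in> Ult C. ult_vimage B f y \<in> E}"

lemma ult_vimage_Ult:
  assumes B: "boolean_alg B" and C: "boolean_alg C" and f: "boolean_hom B C f" and y: "y \<in> Ult C"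
  shows "ult_vimage B f y \<in> Ult B"
proof -
  have fc: "\<And>a. a \<in> carrier B \<Longrightarrow> f a \<in> carrier C"
    and f01: "f (bzero B) = bzero C" "f (bone B) = bone C"
    and fn: "\<And>a. a \<in> carrier B \<Longrightarrow> f (neg B a) = neg C (f a)"
    and fm: "\<And>a b. a \<in> carrier B \<Longrightarrow> b \<in> carrier B \<Longrightarrow> f (meet B a b) = meet C (f a) (f b)"
    using f unfolding boolean_hom_def by auto
  have "ult_vimage B f y \<subseteq> carrier B" "bone B \<in> ult_vimage B f y" "bzero B \<notin> ult_vimage B f y"
    using UltD(2,3)[OF C y] ba_closed(1,2)[OF B] by (auto simp: ult_vimage_def f01)
  moreover have "meet B a b \<in> ult_vimage B f y"
    if "a \<in> ult_vimage B f y" "b \<in> ult_vimage B f y" for a b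
    using that UltD(4)[OF C y] ba_closed(4)[OF B] by (simp add: ult_vimage_def fm)
  moreover have "b \<in> ult_vimage B f y"
    if "a \<in> ult_vimage B f y" "b \<in> carrier B" "ble B a b" for a b
    using that UltD(5)[OF C y, of "f a" "f b"] boolean_hom_ble[OF f] fc
    by (simp add: ult_vimage_def)
  moreover have "a \<in> ult_vimage B f y \<or> neg B a \<in> ult_vimage B f y" if "a \<in> carrier B" for a
    using that UltD(6)[OF C y fc] ba_closed(3)[OF B] by (auto simp: ult_vimage_def fn)
  ultimately show ?thesis unfolding Ult_def by blast
qed

lemma ult_vimage_eq:
  assumes B: "boolean_alg B" and C: "boolean_alg C" and f: "boolean_hom B C f"
    and y: "y \<in> Ult C" and x: "x \<in> Ult B" and fx: "f ` x \<subseteq> y"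
  shows "ult_vimage B f y = x"
proof -
  have "x \<subseteq> ult_vimage B f y" using fx UltD(1)[OF B x] unfolding ult_vimage_def by auto
  then show ?thesis using Ult_maximal[OF B x ult_vimage_Ult[OF B C f y]] by simp
qed

lemma ba_filter_image:
  assumes B: "boolean_alg B" and C: "boolean_alg C" and f: "boolean_hom B C f"
    and x: "ba_filter B x"
  shows "ba_filter C {c \<in> carrier C. \<exists>a\<in>x. ble C (f a) c}" (is "ba_filter C ?F")
proof -
  have fc: "\<And>a. a \<in> carrier B \<Longrightarrow> f a \<in> carrier C"
    and f1: "f (bone B) = bone C"
    and fm: "\<And>a b. a \<in> carrier B \<Longrightarrow> b \<in> carrier B \<Longrightarrow> f (meet B a b) = meet C (f a) (f b)"
    using f unfolding boolean_hom_def by auto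
  have x1: "bone B \<in> x" and xm: "\<And>a b. a \<in> x \<Longrightarrow> b \<in> x \<Longrightarrow> meet B a b \<in> x"
    and xc: "\<And>a. a \<in> x \<Longrightarrow> a \<in> carrier B"
    using x unfolding ba_filter_def by auto
  show ?thesis
    unfolding ba_filter_def
  proof (intro conjI ballI impI)
    show "?F \<subseteq> carrier C" by auto
    show "bone C \<in> ?F" using x1 f1 ba_closed(2)[OF C] ble_refl[OF C] by force
  next
    fix c d assume "c \<in> ?F" "d \<in> ?F"
    then obtain a b where *: "c \<in> carrier C" "d \<in> carrier C" "a \<in> x" "b \<in> x"
      "ble C (f a) c" "ble C (f b) d" by auto
    then have "ble C (f (meet B a b)) (meet C c d)"
      using ble_meet_mono[OF C *(5,6)] fm fc xc by simp
    then show "meet C c d \<in> ?F" using * xm ba_closed(4)[OF C] by blast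
  next
    fix c d assume "c \<in> ?F" and d: "d \<in> carrier C" "ble C c d"
    then obtain a where "c \<in> carrier C" "a \<in> x" "ble C (f a) c" by auto
    then have "ble C (f a) d" using ble_trans[OF C] d fc xc by blast
    then show "d \<in> ?F" using \<open>a \<in> x\<close> d by blast
  qed
qed

lemma dual_rel_ult_vimage_iff:
  assumes B: "subordination_alg B" and C: "subordination_alg C" and f: "sub_morphism B C f"
    and x: "x \<in> Ult C" and z: "z \<in> Ult B"
  shows "dual_rel B (ult_vimage B f x) z \<longleftrightarrow> (\<exists>y\<in>Ult C. ult_vimage B f y = z \<and> dual_rel C x y)"
proof -
  note BA = subordination_alg_boolean[OF B] and CA = subordination_alg_boolean[OF C]
  have h: "boolean_hom B C f"
    and fp: "\<And>a b. a \<in> carrier B \<Longrightarrow> b \<in> carrier B \<Longrightarrow> prec B a b \<Longrightarrow> prec C (f a) (f b)"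
    and lift: "\<And>a c. a \<in> carrier B \<Longrightarrow> c \<in> carrier C \<Longrightarrow> prec C (f a) c \<Longrightarrow>
        \<exists>b\<in>carrier B. prec B a b \<and> ble C (f b) c"
    using f unfolding sub_morphism_def by auto
  have fc: "\<And>a. a \<in> carrier B \<Longrightarrow> f a \<in> carrier C" using h unfolding boolean_hom_def by auto
  have zB: "z \<subseteq> carrier B" by (rule UltD(1)[OF BA z])
  show ?thesis
  proof
    assume "\<exists>y\<in>Ult C. ult_vimage B f y = z \<and> dual_rel C x y"
    then obtain y where y: "y \<in> Ult C" "ult_vimage B f y = z" "dual_rel C x y" by auto
    show "dual_rel B (ult_vimage B f x) z"
      using y(2,3) fp fc unfolding dual_rel_def ult_vimage_def by blast
  next
    assume R: "dual_rel B (ult_vimage B f x) z"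
    let ?I = "{c \<in> carrier C. \<exists>d\<in>carrier C. prec C c d \<and> d \<notin> x}"
    let ?F = "{c \<in> carrier C. \<exists>a\<in>z. ble C (f a) c}"
    have "?F \<inter> ?I = {}"
    proof (rule ccontr)
      assume "\<not> ?thesis"
      then obtain c d a where *: "c \<in> carrier C" "d \<in> carrier C" "a \<in> z" "ble C (f a) c"
        "prec C c d" "d \<notin> x" by blast
      then have a: "a \<in> carrier B" using zB by blast
      then have "prec C (f a) d" using prec_mono[OF C *(4,5) ble_refl[OF CA]] * fc by blast
      then obtain b where b: "b \<in> carrier B" "prec B a b" "ble C (f b) d" using lift a * by blast
      then have "f b \<in> x" using R * unfolding dual_rel_def ult_vimage_def by blast
      then show False using UltD(5)[OF CA x] b * by blast
    qed
    then obtain y where y: "y \<in> Ult C" "?F \<subseteq> y" "y \<inter> ?I = {}"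
      by (rule ultrafilter_separation[OF CA ba_filter_image[OF BA CA h ba_filter_Ult[OF BA z]]
            ba_ideal_not_prec[OF C x]])
    have "f ` z \<subseteq> y" using y(2) zB fc ble_refl[OF CA] by blast
    then have "ult_vimage B f y = z" by (rule ult_vimage_eq[OF BA CA h y(1) z])
    moreover have "dual_rel C x y"
      using dual_rel_iff_disjoint[OF UltD(1)[OF CA y(1)]] y(3) by simp
    ultimately show "\<exists>y\<in>Ult C. ult_vimage B f y = z \<and> dual_rel C x y" using y(1) by blast
  qed
qed

context
  fixes B :: "'a subord" and C :: "'b subord" and f :: "'a \<Rightarrow> 'b"
  assumes B: "subordination_alg B" and C: "subordination_alg C" and f: "sub_morphism B C f"
begin

lemma sub_morphism_hom: "boolean_hom B C f"
  using f unfolding sub_morphism_def by auto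

lemma sub_morphism_closed: "a \<in> carrier B \<Longrightarrow> f a \<in> carrier C"
  using sub_morphism_hom unfolding boolean_hom_def by auto

text \<open>Inverse images preserve the set operations; the diamond is preserved by summing
  \<open>dual_rel_ult_vimage_iff\<close> over all \<open>z\<close> in the set.\<close>

lemma dual_map_modal_hom: "modal_hom (delta B) (delta C) (dual_map B C f)"
proof -
  have u: "\<And>y. y \<in> Ult C \<Longrightarrow> ult_vimage B f y \<in> Ult B"
    by (rule ult_vimage_Ult[OF subordination_alg_boolean[OF B] subordination_alg_boolean[OF C]
          sub_morphism_hom])
  have "dual_map B C f (dia (delta B) E) = dia (delta C) (dual_map B C f E)" if "E \<subseteq> Ult B" for E
  proof -
    have "(\<exists>z\<in>E. dual_rel B (ult_vimage B f x) z) \<longleftrightarrow>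
        (\<exists>y\<in>Ult C. ult_vimage B f y \<in> E \<and> dual_rel C x y)" if x: "x \<in> Ult C" for x
    proof -
      have "(\<exists>z\<in>E. dual_rel B (ult_vimage B f x) z) \<longleftrightarrow>
          (\<exists>z\<in>E. \<exists>y\<in>Ult C. ult_vimage B f y = z \<and> dual_rel C x y)"
        using \<open>E \<subseteq> Ult B\<close> by (intro bex_cong refl dual_rel_ult_vimage_iff[OF B C f x]) auto
      then show ?thesis by auto
    qed
    then show ?thesis using u by (auto simp: dual_map_def)
  qed
  then show ?thesis
    using u unfolding modal_hom_def boolean_hom_def dual_map_def by auto
qed

lemma dual_map_ult_rep: "a \<in> carrier B \<Longrightarrow> dual_map B C f (ult_rep B a) = ult_rep C (f a)"
  using ult_vimage_Ult[OF subordination_alg_boolean[OF B] subordination_alg_boolean[OF C]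
      sub_morphism_hom]
  unfolding dual_map_def ult_rep_def by (auto simp: ult_vimage_def)

lemma dual_map_interp:
  assumes "range v \<subseteq> carrier B"
  shows "dual_map B C f (interp (delta B) (ult_rep B \<circ> v) \<phi>) =
    interp (delta C) (ult_rep C \<circ> (f \<circ> v)) \<phi>"
proof -
  have "dual_map B C f \<circ> (ult_rep B \<circ> v) = ult_rep C \<circ> (f \<circ> v)"
    using assms dual_map_ult_rep by (auto simp: fun_eq_iff)
  then show ?thesis
    using modal_hom_interp[OF modal_alg_delta dual_map_modal_hom, of "ult_rep B \<circ> v"]
      ult_rep_comp_range[of B v] by simp
qed

text \<open>Valuations in \<open>C\<close> lift along the surjection, and the dual map carries top
  to top.\<close>

lemma valid_surj_image:
  assumes surj: "f ` carrier B = carrier C" and \<phi>: "valid B \<phi>"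
  shows "valid C \<phi>"
  unfolding valid_alt
proof (intro allI impI)
  fix w :: "nat \<Rightarrow> 'b" assume w: "range w \<subseteq> carrier C"
  define v where "v p = inv_into (carrier B) f (w p)" for p
  have v: "range v \<subseteq> carrier B" "f \<circ> v = w"
    using w surj by (auto simp: v_def fun_eq_iff image_subset_iff inv_into_into f_inv_into_f)
  have "interp (delta C) (ult_rep C \<circ> w) \<phi> = dual_map B C f (Ult B)"
    using dual_map_interp[OF v(1), of \<phi>] v \<phi> unfolding valid_alt by simp
  also have "\<dots> = Ult C"
    using dual_map_modal_hom unfolding modal_hom_def boolean_hom_def by simp
  finally show "interp (delta C) (ult_rep C \<circ> w) \<phi> = Ult C" .
qed

lemma ult_vimage_surj:
  assumes inj: "inj_on f (carrier B)" and x: "x \<in> Ult B"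
  obtains y where "y \<in> Ult C" "ult_vimage B f y = x"
proof -
  note BA = subordination_alg_boolean[OF B] and CA = subordination_alg_boolean[OF C]
  let ?F = "{c \<in> carrier C. \<exists>a\<in>x. ble C (f a) c}"
  have xB: "x \<subseteq> carrier B" by (rule UltD(1)[OF BA x])
  have f0: "f (bzero B) = bzero C" using sub_morphism_hom unfolding boolean_hom_def by auto
  have "?F \<inter> {c \<in> carrier C. ble C c (bzero C)} = {}"
  proof (rule ccontr)
    assume "\<not> ?thesis"
    then obtain c a where *: "c \<in> carrier C" "a \<in> x" "ble C (f a) c" "ble C c (bzero C)" by blast
    then have a: "a \<in> carrier B" using xB by blast
    then have fa: "f a \<in> carrier C" by (rule sub_morphism_closed)
    have "ble C (f a) (bzero C)" using ble_trans[OF CA *(3,4) fa *(1)] ba_closed(1)[OF CA] by blast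
    then have "f a = f (bzero B)"
      using ble_antisym[OF CA] ble_bounds(1)[OF CA fa] fa f0 ba_closed(1)[OF CA] by metis
    then have "a = bzero B" using inj a ba_closed(1)[OF BA] by (auto dest: inj_onD)
    then show False using UltD(3)[OF BA x] * by blast
  qed
  then obtain y where y: "y \<in> Ult C" "?F \<subseteq> y"
    by (rule ultrafilter_separation[OF CA ba_filter_image[OF BA CA sub_morphism_hom ba_filter_Ult[OF BA x]]
          ba_ideal_down[OF CA ba_closed(1)[OF CA]]])
  have "f ` x \<subseteq> y" using y(2) xB sub_morphism_closed ble_refl[OF CA] by blast
  then show thesis using that y ult_vimage_eq[OF BA CA sub_morphism_hom y(1) x] by blast
qed

text \<open>The value in \<open>delta B\<close> is sent to all of \<open>Ult C\<close>, so it
  contains every \<open>ult_vimage B f y\<close>, and these exhaust \<open>Ult B\<close>.\<close>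

lemma valid_inj_reflect:
  assumes inj: "inj_on f (carrier B)" and \<phi>: "valid C \<phi>"
  shows "valid B \<phi>"
  unfolding valid_alt
proof (intro allI impI)
  fix v :: "nat \<Rightarrow> 'a" assume v: "range v \<subseteq> carrier B"
  have "range (f \<circ> v) \<subseteq> carrier C" using v sub_morphism_closed by auto
  then have *: "dual_map B C f (interp (delta B) (ult_rep B \<circ> v) \<phi>) = Ult C"
    using dual_map_interp[OF v, of \<phi>] \<phi> unfolding valid_alt by simp
  have "x \<in> interp (delta B) (ult_rep B \<circ> v) \<phi>" if "x \<in> Ult B" for x
    using ult_vimage_surj[OF inj that] * unfolding dual_map_def by blast
  moreover have "interp (delta B) (ult_rep B \<circ> v) \<phi> \<subseteq> Ult B"
    using interp_closed[OF modal_alg_delta, of "ult_rep B \<circ> v" B] ult_rep_comp_range[of B v] by simp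
  ultimately show "interp (delta B) (ult_rep B \<circ> v) \<phi> = Ult B" by blast
qed

end

section \<open>Modalisation and validity of schemes\<close>

text \<open>The modalisation as a modal algebra, keeping the diamond that
  \<open>modalisation\<close> converts into \<open>prec\<close>, with the hull replaced by its
  description by terms.\<close>

definition modm :: "'a subord \<Rightarrow> 'a set set modal" where
  "modm B = (delta B)\<lparr>carrier := generated (delta B) (ult_rep B ` carrier B)\<rparr>"

lemma modm_simps [simp]:
  "carrier (modm B) = generated (delta B) (ult_rep B ` carrier B)" "bone (modm B) = Ult B"
  "interp (modm B) v \<phi> = interp (delta B) v \<phi>"
  by (simp_all add: modm_def)

lemma ult_rep_image_nonempty: "boolean_alg B \<Longrightarrow> ult_rep B ` carrier B \<noteq> {}"
  using ba_closed(1) by blast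

lemma hull_ult_rep:
  assumes "boolean_alg B"
  shows "modal_subuniverse (delta B) hull (ult_rep B ` carrier B) =
    generated (delta B) (ult_rep B ` carrier B)"
  by (intro generated_hull modal_alg_delta ult_rep_image_nonempty assms) (simp add: ult_rep_range)

lemma modalisation_eq: "boolean_alg B \<Longrightarrow> modalisation B = sub_of_modal (modm B)"
  by (simp add: modalisation_def modm_def hull_ult_rep)

lemma carrier_modm_subset: "carrier (modm B) \<subseteq> Pow (Ult B)"
proof -
  have "interp (delta B) v \<phi> \<in> Pow (Ult B)" if "range v \<subseteq> ult_rep B ` carrier B" for v \<phi>
    using interp_closed[OF modal_alg_delta, of v B \<phi>] that ult_rep_range[of B] by simp
  then show ?thesis by (auto simp: generated_def)
qed

lemma interp_ult_rep_in_modm: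
  assumes "range v \<subseteq> carrier B"
  shows "interp (delta B) (ult_rep B \<circ> v) \<phi> \<in> carrier (modm B)"
  unfolding modm_simps generated_def
  by (intro CollectI exI conjI refl) (use assms in auto)

lemma modal_alg_modm: "boolean_alg B \<Longrightarrow> modal_alg (modm B)"
  unfolding modm_def
  by (intro modal_alg_carrier_update modal_alg_delta modal_subuniverse_generated
      ult_rep_image_nonempty) (simp add: ult_rep_range)

lemma subordination_alg_modalisation: "boolean_alg B \<Longrightarrow> subordination_alg (modalisation B)"
  by (simp add: modalisation_eq subordination_alg_sub_of_modal modal_alg_modm)

lemma mvalid_subst:
  assumes "modal_alg M" "mvalid M \<phi>"
  shows "mvalid M (subst \<sigma> \<phi>)"
  unfolding mvalid_def interp_subst
proof (intro allI impI)
  fix v :: "nat \<Rightarrow> 'a" assume "range v \<subseteq> carrier M"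
  then have "range (\<lambda>p. interp M v (\<sigma> p)) \<subseteq> carrier M" using interp_closed[OF assms(1)] by auto
  then show "interp M (\<lambda>p. interp M v (\<sigma> p)) \<phi> = bone M" using assms(2) by (simp add: mvalid_def)
qed

text \<open>The values of the variables of \<open>\<phi>\<close> in the modalisation are given by formulas over
  valuations in \<open>B\<close>; \<open>prod_encode\<close> makes the variables of these countably many formulas disjoint.\<close>

lemma valid_schemes_iff:
  "(\<forall>\<sigma>. valid B (subst \<sigma> \<phi>)) \<longleftrightarrow> mvalid (modm B) \<phi>"
proof
  assume *: "\<forall>\<sigma>. valid B (subst \<sigma> \<phi>)"
  show "mvalid (modm B) \<phi>"
    unfolding mvalid_def
  proof (intro allI impI)
    fix u :: "nat \<Rightarrow> _" assume u: "range u \<subseteq> carrier (modm B)"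
    have "\<exists>w \<psi>. range w \<subseteq> carrier B \<and> u p = interp (delta B) (ult_rep B \<circ> w) \<psi>" for p
    proof -
      have "u p \<in> generated (delta B) (ult_rep B ` carrier B)" using u by auto
      then obtain w' \<psi> where w: "range w' \<subseteq> ult_rep B ` carrier B" "u p = interp (delta B) w' \<psi>"
        unfolding generated_def by auto
      have "w' = ult_rep B \<circ> (\<lambda>q. inv_into (carrier B) (ult_rep B) (w' q))"
        using w(1) by (auto simp: fun_eq_iff image_subset_iff f_inv_into_f)
      moreover have "range (\<lambda>q. inv_into (carrier B) (ult_rep B) (w' q)) \<subseteq> carrier B"
        using w(1) by (auto simp: image_subset_iff inv_into_into)
      ultimately show ?thesis using w(2) by metis
    qed
    then obtain w \<psi> where w: "\<And>p. range (w p) \<subseteq> carrier B"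
      "\<And>p. u p = interp (delta B) (ult_rep B \<circ> w p) (\<psi> p)" by metis
    define v where "v n = w (fst (prod_decode n)) (snd (prod_decode n))" for n
    define \<sigma> where "\<sigma> p = subst (\<lambda>q. Var (prod_encode (p, q))) (\<psi> p)" for p
    have v: "range v \<subseteq> carrier B" using w(1) by (auto simp: v_def)
    have "interp (delta B) (ult_rep B \<circ> v) (\<sigma> p) = u p" for p
      by (simp add: \<sigma>_def interp_subst w(2) v_def comp_def)
    then have "interp (delta B) (ult_rep B \<circ> v) (subst \<sigma> \<phi>) = interp (delta B) u \<phi>"
      by (simp add: interp_subst)
    then show "interp (modm B) u \<phi> = bone (modm B)" using * v unfolding valid_alt by auto
  qed
next
  assume *: "mvalid (modm B) \<phi>"
  show "\<forall>\<sigma>. valid B (subst \<sigma> \<phi>)"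
    unfolding valid_alt
  proof (intro allI impI)
    fix \<sigma> :: "nat \<Rightarrow> fm" and v :: "nat \<Rightarrow> 'a" assume v: "range v \<subseteq> carrier B"
    have "range (\<lambda>p. interp (delta B) (ult_rep B \<circ> v) (\<sigma> p)) \<subseteq> carrier (modm B)"
      using interp_ult_rep_in_modm[OF v] by blast
    then show "interp (delta B) (ult_rep B \<circ> v) (subst \<sigma> \<phi>) = Ult B"
      using * unfolding mvalid_def interp_subst by simp
  qed
qed

text \<open>Says that \<open>prec\<close> comes from a diamond without naming one. Isomorphic copies
  on \<open>'u\<close> have only a \<open>prec\<close>, and this property passes to them.\<close>

definition has_dia :: "'a subord \<Rightarrow> bool" where
  "has_dia B \<longleftrightarrow> (\<forall>a\<in>carrier B. \<exists>d\<in>carrier B. \<forall>b\<in>carrier B. prec B a b \<longleftrightarrow> ble B d b)"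

lemma has_dia_sub_of_modal: "modal_alg M \<Longrightarrow> has_dia (sub_of_modal M)"
  unfolding has_dia_def modal_alg_def by auto

text \<open>By \<open>dia_ult_rep\<close> the image of the canonical embedding is already closed
  under the diamond, so generating adds no element.\<close>

lemma carrier_modm_has_dia:
  assumes B: "subordination_alg B" and d: "has_dia B"
  shows "carrier (modm B) = ult_rep B ` carrier B"
proof -
  note BA = subordination_alg_boolean[OF B]
  have h: "boolean_hom B (delta B) (ult_rep B)" by (rule ult_rep_boolean_hom[OF BA])
  have "modal_subuniverse (delta B) (ult_rep B ` carrier B)"
    unfolding modal_subuniverse_def boolean_subuniverse_def
  proof (intro conjI ballI)
    show "ult_rep B ` carrier B \<subseteq> carrier (delta B)" by (simp add: ult_rep_range)
    show "bzero (delta B) \<in> ult_rep B ` carrier B" "bone (delta B) \<in> ult_rep B ` carrier B"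
      using h ba_closed(1,2)[OF BA] unfolding boolean_hom_def by (metis imageI)+
  next
    fix E assume "E \<in> ult_rep B ` carrier B"
    then obtain a where a: "a \<in> carrier B" "E = ult_rep B a" by auto
    show "neg (delta B) E \<in> ult_rep B ` carrier B"
      using h a ba_closed(3)[OF BA] unfolding boolean_hom_def by (metis imageI)
    obtain e where "e \<in> carrier B" "\<And>b. b \<in> carrier B \<Longrightarrow> prec B a b \<longleftrightarrow> ble B e b"
      using d a unfolding has_dia_def by blast
    then have "dia (delta B) (ult_rep B a) = ult_rep B e" by (rule dia_ult_rep[OF B a(1)])
    then show "dia (delta B) E \<in> ult_rep B ` carrier B" using \<open>e \<in> carrier B\<close> a by auto
  next
    fix E F assume "E \<in> ult_rep B ` carrier B" "F \<in> ult_rep B ` carrier B"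
    then obtain a b where a: "a \<in> carrier B" "E = ult_rep B a" "b \<in> carrier B" "F = ult_rep B b"
      by auto
    show "meet (delta B) E F \<in> ult_rep B ` carrier B" "join (delta B) E F \<in> ult_rep B ` carrier B"
      using h a ba_closed(4,5)[OF BA] unfolding boolean_hom_def by (metis imageI)+
  qed
  then have "modal_subuniverse (delta B) hull (ult_rep B ` carrier B) = ult_rep B ` carrier B"
    by (rule hull_same)
  then show ?thesis unfolding hull_ult_rep[OF BA] modm_simps .
qed

lemma ult_rep_modal_hom:
  assumes M: "modal_alg M"
  shows "modal_hom M (delta (sub_of_modal M)) (ult_rep (sub_of_modal M))"
proof -
  let ?B = "sub_of_modal M"
  have B: "subordination_alg ?B" by (rule subordination_alg_sub_of_modal[OF M])
  have "boolean_hom M (delta ?B) (ult_rep ?B)"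
    using ult_rep_boolean_hom[OF subordination_alg_boolean[OF B]]
    unfolding boolean_hom_def sub_of_modal_simps by assumption
  moreover have "ult_rep ?B (dia M a) = dia (delta ?B) (ult_rep ?B a)" if a: "a \<in> carrier M" for a
  proof -
    have "dia M a \<in> carrier M" using M a unfolding modal_alg_def by blast
    then show ?thesis using dia_ult_rep[OF B, of a "dia M a"] a by simp
  qed
  ultimately show ?thesis unfolding modal_hom_def by blast
qed

text \<open>The canonical embedding is an injective modal homomorphism here, so a value is all of
  \<open>Ult\<close> exactly when it is top in \<open>M\<close>.\<close>

lemma valid_sub_of_modal:
  assumes M: "modal_alg M"
  shows "valid (sub_of_modal M) \<phi> \<longleftrightarrow> mvalid M \<phi>"
proof -
  let ?B = "sub_of_modal M"
  have "interp (delta ?B) (ult_rep ?B \<circ> v) \<phi> = Ult ?B \<longleftrightarrow> interp M v \<phi> = bone M"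
    if v: "range v \<subseteq> carrier M" for v
  proof -
    have "interp (delta ?B) (ult_rep ?B \<circ> v) \<phi> = ult_rep ?B (interp M v \<phi>)"
      by (rule modal_hom_interp[OF M ult_rep_modal_hom[OF M] v, symmetric])
    moreover have "ult_rep ?B (bone M) = Ult ?B"
      using ult_rep_modal_hom[OF M] unfolding modal_hom_def boolean_hom_def by simp
    moreover have "inj_on (ult_rep ?B) (carrier M)"
      using ult_rep_inj[of ?B] modal_alg_boolean[OF M] by simp
    ultimately show ?thesis
      using interp_closed[OF M v] ba_closed(2)[OF modal_alg_boolean[OF M]] by (metis inj_on_eq_iff)
  qed
  then show ?thesis unfolding valid_alt mvalid_def by auto
qed

text \<open>Both sides say that the modal algebra \<open>modm B\<close> validates \<phi>, whose
  validity there is closed under substitution. Closure under modalisation and its reflection both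
  follow.\<close>

lemma valid_schemes_modalisation:
  assumes "boolean_alg B"
  shows "(\<forall>\<sigma>. valid (modalisation B) (subst \<sigma> \<phi>)) \<longleftrightarrow> (\<forall>\<sigma>. valid B (subst \<sigma> \<phi>))"
  unfolding modalisation_eq[OF assms] valid_sub_of_modal[OF modal_alg_modm[OF assms]]
    valid_schemes_iff[of B]
  using mvalid_subst[OF modal_alg_modm[OF assms]] by (metis subst_Var)

section \<open>Products and isomorphic copies\<close>

text \<open>Equations can be checked after applying a jointly injective family of homomorphisms.
  With its analogue for subordination algebras this handles products, subalgebras and transported
  copies uniformly.\<close>

lemma boolean_alg_joint_embedding:
  assumes A: "\<And>i. i \<in> I \<Longrightarrow> boolean_alg (A i)"
    and g: "\<And>i. i \<in> I \<Longrightarrow> boolean_hom C (A i) (g i)"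
    and inj: "\<And>a b. a \<in> carrier C \<Longrightarrow> b \<in> carrier C \<Longrightarrow> (\<And>i. i \<in> I \<Longrightarrow> g i a = g i b) \<Longrightarrow> a = b"
    and C: "boolean_subuniverse C (carrier C)"
  shows "boolean_alg C"
proof -
  have cl: "bzero C \<in> carrier C" "bone C \<in> carrier C"
    "\<And>a. a \<in> carrier C \<Longrightarrow> neg C a \<in> carrier C"
    "\<And>a b. a \<in> carrier C \<Longrightarrow> b \<in> carrier C \<Longrightarrow> meet C a b \<in> carrier C"
    "\<And>a b. a \<in> carrier C \<Longrightarrow> b \<in> carrier C \<Longrightarrow> join C a b \<in> carrier C"
    using C unfolding boolean_subuniverse_def by auto
  have gc: "\<And>i a. i \<in> I \<Longrightarrow> a \<in> carrier C \<Longrightarrow> g i a \<in> carrier (A i)"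
    and gh: "\<And>i. i \<in> I \<Longrightarrow> g i (bzero C) = bzero (A i)" "\<And>i. i \<in> I \<Longrightarrow> g i (bone C) = bone (A i)"
    "\<And>i a. i \<in> I \<Longrightarrow> a \<in> carrier C \<Longrightarrow> g i (neg C a) = neg (A i) (g i a)"
    "\<And>i a b. i \<in> I \<Longrightarrow> a \<in> carrier C \<Longrightarrow> b \<in> carrier C \<Longrightarrow> g i (meet C a b) = meet (A i) (g i a) (g i b)"
    "\<And>i a b. i \<in> I \<Longrightarrow> a \<in> carrier C \<Longrightarrow> b \<in> carrier C \<Longrightarrow> g i (join C a b) = join (A i) (g i a) (g i b)"
    using g unfolding boolean_hom_def by (auto simp: Pi_iff)
  show ?thesis
    unfolding boolean_alg_def
    by (intro conjI ballI C; rule inj; simp only: cl gh;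
        (rule ba_eqs[OF A] ba_units[OF A]; assumption?; rule gc; assumption)?)
qed

lemma subordination_alg_joint_embedding:
  assumes A: "\<And>i. i \<in> I \<Longrightarrow> subordination_alg (A i)"
    and g: "\<And>i. i \<in> I \<Longrightarrow> boolean_hom C (A i) (g i)"
    and inj: "\<And>a b. a \<in> carrier C \<Longrightarrow> b \<in> carrier C \<Longrightarrow> (\<And>i. i \<in> I \<Longrightarrow> g i a = g i b) \<Longrightarrow> a = b"
    and C: "boolean_subuniverse C (carrier C)"
    and prec: "\<And>a b. a \<in> carrier C \<Longrightarrow> b \<in> carrier C \<Longrightarrow>
      prec C a b \<longleftrightarrow> (\<forall>i\<in>I. prec (A i) (g i a) (g i b))"
  shows "subordination_alg C"
proof -
  have CA: "boolean_alg C"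
    by (rule boolean_alg_joint_embedding[OF subordination_alg_boolean[OF A] g inj C])
  have gc: "\<And>i a. i \<in> I \<Longrightarrow> a \<in> carrier C \<Longrightarrow> g i a \<in> carrier (A i)"
    and gh: "\<And>i. i \<in> I \<Longrightarrow> g i (bzero C) = bzero (A i)" "\<And>i. i \<in> I \<Longrightarrow> g i (bone C) = bone (A i)"
    "\<And>i a. i \<in> I \<Longrightarrow> a \<in> carrier C \<Longrightarrow> g i (neg C a) = neg (A i) (g i a)"
    "\<And>i a b. i \<in> I \<Longrightarrow> a \<in> carrier C \<Longrightarrow> b \<in> carrier C \<Longrightarrow> g i (meet C a b) = meet (A i) (g i a) (g i b)"
    "\<And>i a b. i \<in> I \<Longrightarrow> a \<in> carrier C \<Longrightarrow> b \<in> carrier C \<Longrightarrow> g i (join C a b) = join (A i) (g i a) (g i b)"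
    using g unfolding boolean_hom_def by (auto simp: Pi_iff)
  note cl = ba_closed[OF CA]
  show ?thesis
    unfolding subordination_alg_def
  proof (intro conjI ballI impI CA)
    show "prec C (bzero C) (bzero C)" "prec C (bone C) (bone C)"
      using A cl(1,2) by (auto simp: prec gh subordination_alg_def)
  next
    fix a b c assume *: "a \<in> carrier C" "b \<in> carrier C" "c \<in> carrier C" "prec C a b" "prec C a c"
    have "prec (A i) (g i a) (g i (meet C b c))" if i: "i \<in> I" for i
      using A[OF i] * i gc[OF i] unfolding subordination_alg_def by (simp add: prec gh)
    then show "prec C a (meet C b c)" using * cl(4) prec by simp
  next
    fix a b c assume *: "a \<in> carrier C" "b \<in> carrier C" "c \<in> carrier C" "prec C b a" "prec C c a"
    have "prec (A i) (g i (join C b c)) (g i a)" if i: "i \<in> I" for i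
      using A[OF i] * i gc[OF i] unfolding subordination_alg_def by (simp add: prec gh)
    then show "prec C (join C b c) a" using * cl(5) prec by simp
  next
    fix a b c d assume *: "a \<in> carrier C" "b \<in> carrier C" "c \<in> carrier C" "d \<in> carrier C"
      "ble C a b" "prec C b c" "ble C c d"
    have "prec (A i) (g i a) (g i d)" if i: "i \<in> I" for i
      by (rule prec_mono[OF A[OF i], of _ "g i b" "g i c"])
        (use * i gc[OF i] boolean_hom_ble[OF g[OF i]] prec[of b c] in auto)
    then show "prec C a d" using * prec by simp
  qed
qed

section \<open>Products of subordination algebras\<close>

lemma prod_alg_simps:
  "carrier (prod_alg I A) = (\<Pi>\<^sub>E i\<in>I. carrier (A i))"
  "meet (prod_alg I A) a b = (\<lambda>i\<in>I. meet (A i) (a i) (b i))"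
  "join (prod_alg I A) a b = (\<lambda>i\<in>I. join (A i) (a i) (b i))"
  "neg (prod_alg I A) a = (\<lambda>i\<in>I. neg (A i) (a i))"
  "bzero (prod_alg I A) = (\<lambda>i\<in>I. bzero (A i))"
  "bone (prod_alg I A) = (\<lambda>i\<in>I. bone (A i))"
  "prec (prod_alg I A) a b \<longleftrightarrow> (\<forall>i\<in>I. prec (A i) (a i) (b i))"
  by (simp_all add: prod_alg_def)

lemma prod_alg_projection_hom: "i \<in> I \<Longrightarrow> boolean_hom (prod_alg I A) (A i) (\<lambda>a. a i)"
  by (auto simp: boolean_hom_def prod_alg_simps)

lemma subordination_alg_prod:
  assumes A: "\<And>i. i \<in> I \<Longrightarrow> subordination_alg (A i)"
  shows "subordination_alg (prod_alg I A)"
proof (rule subordination_alg_joint_embedding[where I = I and A = A and g = "\<lambda>i a. a i"])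
  show "boolean_subuniverse (prod_alg I A) (carrier (prod_alg I A))"
    using ba_closed[OF subordination_alg_boolean[OF A]]
    unfolding boolean_subuniverse_def prod_alg_simps by (auto simp: PiE_iff)
  show "a = b" if "a \<in> carrier (prod_alg I A)" "b \<in> carrier (prod_alg I A)"
    "\<And>i. i \<in> I \<Longrightarrow> a i = b i" for a b
    using that unfolding prod_alg_simps by (rule PiE_ext)
qed (simp_all add: A prod_alg_projection_hom prod_alg_simps(7))

lemma prod_alg_projection_morphism:
  assumes A: "\<And>i. i \<in> I \<Longrightarrow> subordination_alg (A i)" and i: "i \<in> I"
  shows "sub_morphism (prod_alg I A) (A i) (\<lambda>a. a i)"
    and "(\<lambda>a. a i) ` carrier (prod_alg I A) = carrier (A i)"
proof -
  let ?P = "prod_alg I A"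
  note AA = subordination_alg_boolean[OF A]
  \<comment> \<open>The witness for the back condition has \<open>c\<close> in coordinate
    \<open>i\<close> and top elsewhere; every element is subordinate to top, so the other
    coordinates impose nothing.\<close>
  define b where "b c = (\<lambda>j\<in>I. if j = i then c else bone (A j))" for c
  have b: "b c \<in> carrier ?P" "b c i = c" if "c \<in> carrier (A i)" for c
    using that i ba_closed(2)[OF AA] by (auto simp: b_def prod_alg_simps)
  show "(\<lambda>a. a i) ` carrier ?P = carrier (A i)"
  proof
    show "(\<lambda>a. a i) ` carrier ?P \<subseteq> carrier (A i)" using i by (auto simp: prod_alg_simps)
    show "carrier (A i) \<subseteq> (\<lambda>a. a i) ` carrier ?P"
    proof
      fix c assume "c \<in> carrier (A i)"
      then show "c \<in> (\<lambda>a. a i) ` carrier ?P" using b[of c] by (intro image_eqI[of _ _ "b c"]) auto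
    qed
  qed
  have "prec ?P a (b c)" if "a \<in> carrier ?P" "c \<in> carrier (A i)" "prec (A i) (a i) c" for a c
  proof -
    have "prec (A j) (a j) (bone (A j))" if j: "j \<in> I" for j
    proof (rule prec_mono[OF A[OF j]])
      show "prec (A j) (bone (A j)) (bone (A j))"
        using A[OF j] unfolding subordination_alg_def by blast
      show "a j \<in> carrier (A j)" using \<open>a \<in> carrier ?P\<close> j by (auto simp: prod_alg_simps)
      then show "ble (A j) (a j) (bone (A j))" by (rule ble_bounds(2)[OF AA[OF j]])
    qed (use ba_closed(2)[OF AA[OF j]] ble_refl[OF AA[OF j]] in auto)
    then show ?thesis using that by (auto simp: prod_alg_simps b_def)
  qed
  then have "\<exists>b\<in>carrier ?P. prec ?P a b \<and> ble (A i) (b i) c"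
    if "a \<in> carrier ?P" "c \<in> carrier (A i)" "prec (A i) (a i) c" for a c
    using that b[of c] ble_refl[OF AA[OF i]] by (intro bexI[of _ "b c"]) simp_all
  then show "sub_morphism ?P (A i) (\<lambda>a. a i)"
    unfolding sub_morphism_def using prod_alg_projection_hom[OF i, of A] i
    by (simp add: prod_alg_simps(7))
qed

lemma has_dia_prod:
  assumes "\<And>i. i \<in> I \<Longrightarrow> has_dia (A i)"
  shows "has_dia (prod_alg I A)"
  unfolding has_dia_def
proof
  fix a assume a: "a \<in> carrier (prod_alg I A)"
  have "\<exists>d. \<forall>i\<in>I. d i \<in> carrier (A i) \<and> (\<forall>b\<in>carrier (A i). prec (A i) (a i) b \<longleftrightarrow> ble (A i) (d i) b)"
  proof (intro bchoice ballI)
    fix i assume i: "i \<in> I"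
    then have "a i \<in> carrier (A i)" using a by (auto simp: prod_alg_simps)
    then show "\<exists>y. y \<in> carrier (A i) \<and> (\<forall>b\<in>carrier (A i). prec (A i) (a i) b \<longleftrightarrow> ble (A i) y b)"
      using assms[OF i] unfolding has_dia_def by blast
  qed
  then obtain d where d: "\<And>i. i \<in> I \<Longrightarrow> d i \<in> carrier (A i)"
    "\<And>i b. i \<in> I \<Longrightarrow> b \<in> carrier (A i) \<Longrightarrow> prec (A i) (a i) b \<longleftrightarrow> ble (A i) (d i) b" by blast
  show "\<exists>d\<in>carrier (prod_alg I A). \<forall>b\<in>carrier (prod_alg I A).
      prec (prod_alg I A) a b \<longleftrightarrow> ble (prod_alg I A) d b"
  proof (intro bexI ballI)
    show "restrict d I \<in> carrier (prod_alg I A)" using d by (auto simp: prod_alg_simps)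
    fix b assume "b \<in> carrier (prod_alg I A)"
    then show "prec (prod_alg I A) a b \<longleftrightarrow> ble (prod_alg I A) (restrict d I) b"
      using d by (auto simp: prod_alg_simps ble_def fun_eq_iff PiE_iff)
  qed
qed

section \<open>Isomorphisms and transport of structure\<close>

lemma sub_iso_refl: "sub_iso B B"
  unfolding sub_iso_def boolean_hom_def by (intro exI[of _ "\<lambda>x. x"]) (auto simp: bij_betw_def)

lemma boolean_hom_comp:
  "boolean_hom B C f \<Longrightarrow> boolean_hom C D g \<Longrightarrow> boolean_hom B D (g \<circ> f)"
  unfolding boolean_hom_def by (auto simp: Pi_iff)

lemma sub_iso_sym:
  assumes B: "boolean_alg B" and "sub_iso B C"
  shows "sub_iso C B"
proof -
  obtain f where f: "boolean_hom B C f" "bij_betw f (carrier B) (carrier C)"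
    "\<And>a b. a \<in> carrier B \<Longrightarrow> b \<in> carrier B \<Longrightarrow> prec B a b \<longleftrightarrow> prec C (f a) (f b)"
    using assms unfolding sub_iso_def by auto
  define g where "g = inv_into (carrier B) f"
  have g: "bij_betw g (carrier C) (carrier B)" unfolding g_def by (rule bij_betw_inv_into[OF f(2)])
  have fg: "\<And>c. c \<in> carrier C \<Longrightarrow> f (g c) = c" and gf: "\<And>b. b \<in> carrier B \<Longrightarrow> g (f b) = b"
    unfolding g_def using f(2) by (auto simp: bij_betw_inv_into_right bij_betw_inv_into_left)
  have gc: "\<And>c. c \<in> carrier C \<Longrightarrow> g c \<in> carrier B" using g by (auto dest: bij_betwE)
  have fh: "f (bzero B) = bzero C" "f (bone B) = bone C"
    "\<And>a. a \<in> carrier B \<Longrightarrow> f (neg B a) = neg C (f a)"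
    "\<And>a b. a \<in> carrier B \<Longrightarrow> b \<in> carrier B \<Longrightarrow> f (meet B a b) = meet C (f a) (f b)"
    "\<And>a b. a \<in> carrier B \<Longrightarrow> b \<in> carrier B \<Longrightarrow> f (join B a b) = join C (f a) (f b)"
    using f(1) unfolding boolean_hom_def by auto
  have "boolean_hom C B g"
    unfolding boolean_hom_def
  proof (intro conjI ballI)
    show "g (bzero C) = bzero B" "g (bone C) = bone B"
      using gf ba_closed(1,2)[OF B] fh(1,2) by metis+
  next
    fix a assume a: "a \<in> carrier C"
    show "g (neg C a) = neg B (g a)" using gf[of "neg B (g a)"] a by (simp add: ba_closed[OF B] fh gc fg)
  next
    fix a b assume a: "a \<in> carrier C" "b \<in> carrier C"
    show "g (meet C a b) = meet B (g a) (g b)" "g (join C a b) = join B (g a) (g b)"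
      using gf[of "meet B (g a) (g b)"] gf[of "join B (g a) (g b)"] a
      by (simp_all add: ba_closed[OF B] fh gc fg)
  qed (use gc in auto)
  moreover have "prec C a b \<longleftrightarrow> prec B (g a) (g b)" if "a \<in> carrier C" "b \<in> carrier C" for a b
    using f(3)[of "g a" "g b"] that gc fg by simp
  ultimately show ?thesis unfolding sub_iso_def using g by blast
qed

lemma sub_isoE:
  assumes "sub_iso B C" "boolean_alg C"
  obtains f where "sub_morphism B C f" "bij_betw f (carrier B) (carrier C)"
    "\<And>a b. a \<in> carrier B \<Longrightarrow> b \<in> carrier B \<Longrightarrow> prec B a b \<longleftrightarrow> prec C (f a) (f b)"
proof -
  obtain f where f: "boolean_hom B C f" "bij_betw f (carrier B) (carrier C)"
    "\<And>a b. a \<in> carrier B \<Longrightarrow> b \<in> carrier B \<Longrightarrow> prec B a b \<longleftrightarrow> prec C (f a) (f b)"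
    using assms unfolding sub_iso_def by auto
  have "\<exists>b\<in>carrier B. prec B a b \<and> ble C (f b) c"
    if "a \<in> carrier B" "c \<in> carrier C" "prec C (f a) c" for a c
  proof -
    obtain b where "b \<in> carrier B" "c = f b"
      using f(2) \<open>c \<in> carrier C\<close> unfolding bij_betw_def by auto
    then show ?thesis using that f(3) ble_refl[OF assms(2)] by auto
  qed
  then have "sub_morphism B C f" unfolding sub_morphism_def using f by blast
  then show thesis using that f by blast
qed

lemma sub_iso_morphic_image: "sub_iso B C \<Longrightarrow> boolean_alg C \<Longrightarrow> morphic_image B C"
  unfolding morphic_image_def by (metis sub_isoE bij_betw_imp_surj_on)

lemma sub_iso_valid:
  assumes "sub_iso B C" "subordination_alg B" "subordination_alg C"
  shows "valid B \<phi> \<longleftrightarrow> valid C \<phi>"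
  by (rule sub_isoE[OF assms(1) subordination_alg_boolean[OF assms(3)]])
    (metis valid_surj_image valid_inj_reflect bij_betw_def assms(2,3))

lemma sub_iso_has_dia:
  assumes "sub_iso B C" "boolean_alg B" "has_dia C"
  shows "has_dia B"
proof -
  obtain f where f: "boolean_hom B C f" "bij_betw f (carrier B) (carrier C)"
    "\<And>a b. a \<in> carrier B \<Longrightarrow> b \<in> carrier B \<Longrightarrow> prec B a b \<longleftrightarrow> prec C (f a) (f b)"
    using assms unfolding sub_iso_def by auto
  have fc: "\<And>a. a \<in> carrier B \<Longrightarrow> f a \<in> carrier C" using f(2) by (auto dest: bij_betwE)
  have le: "ble B a b \<longleftrightarrow> ble C (f a) (f b)" if "a \<in> carrier B" "b \<in> carrier B" for a b
    using that f(1) ba_closed(4)[OF assms(2)] inj_on_eq_iff[OF bij_betw_imp_inj_on[OF f(2)]]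
    unfolding ble_def boolean_hom_def by metis
  show ?thesis
    unfolding has_dia_def
  proof
    fix a assume a: "a \<in> carrier B"
    then obtain e where e: "e \<in> carrier C" "\<And>b. b \<in> carrier C \<Longrightarrow> prec C (f a) b \<longleftrightarrow> ble C e b"
      using assms(3) fc unfolding has_dia_def by blast
    then obtain d where "d \<in> carrier B" "e = f d" using f(2) unfolding bij_betw_def by auto
    then show "\<exists>d\<in>carrier B. \<forall>b\<in>carrier B. prec B a b \<longleftrightarrow> ble B d b"
      using e a fc f(3) le by auto
  qed
qed

lemma sub_iso_prod:
  assumes "\<And>i. i \<in> I \<Longrightarrow> sub_iso (A i) (C i)"
  shows "sub_iso (prod_alg I A) (prod_alg I C)"
proof -
  have "\<exists>f. \<forall>i\<in>I. boolean_hom (A i) (C i) (f i) \<and> bij_betw (f i) (carrier (A i)) (carrier (C i)) \<and>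
      (\<forall>a\<in>carrier (A i). \<forall>b\<in>carrier (A i). prec (A i) a b \<longleftrightarrow> prec (C i) (f i a) (f i b))"
    using assms unfolding sub_iso_def by (intro bchoice) auto
  then obtain f where f: "\<And>i. i \<in> I \<Longrightarrow> boolean_hom (A i) (C i) (f i)"
    "\<And>i. i \<in> I \<Longrightarrow> bij_betw (f i) (carrier (A i)) (carrier (C i))"
    "\<And>i a b. i \<in> I \<Longrightarrow> a \<in> carrier (A i) \<Longrightarrow> b \<in> carrier (A i) \<Longrightarrow>
      prec (A i) a b \<longleftrightarrow> prec (C i) (f i a) (f i b)" by blast
  define F where "F a = (\<lambda>i\<in>I. f i (a i))" for a
  have "boolean_hom (prod_alg I A) (prod_alg I C) F"
    using f(1) unfolding boolean_hom_def F_def prod_alg_simps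
    by (auto simp: PiE_iff Pi_iff fun_eq_iff)
  moreover have "bij_betw F (carrier (prod_alg I A)) (carrier (prod_alg I C))"
    unfolding bij_betw_def
  proof
    show "inj_on F (carrier (prod_alg I A))"
    proof (rule inj_onI)
      fix a b assume ab: "a \<in> carrier (prod_alg I A)" "b \<in> carrier (prod_alg I A)" "F a = F b"
      have "a i = b i" if i: "i \<in> I" for i
      proof (rule inj_onD[OF bij_betw_imp_inj_on[OF f(2)[OF i]]])
        show "f i (a i) = f i (b i)" using fun_cong[OF ab(3), of i] i by (simp add: F_def)
      qed (use ab i in \<open>auto simp: prod_alg_simps\<close>)
      then show "a = b" using ab by (auto simp: prod_alg_simps intro: PiE_ext)
    qed
    show "F ` carrier (prod_alg I A) = carrier (prod_alg I C)"
    proof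
      show "F ` carrier (prod_alg I A) \<subseteq> carrier (prod_alg I C)"
        using bij_betw_apply[OF f(2)] by (auto simp: F_def prod_alg_simps PiE_iff)
      show "carrier (prod_alg I C) \<subseteq> F ` carrier (prod_alg I A)"
      proof
        fix c assume c: "c \<in> carrier (prod_alg I C)"
        let ?a = "\<lambda>i\<in>I. inv_into (carrier (A i)) (f i) (c i)"
        have ci: "c i \<in> f i ` carrier (A i)" if "i \<in> I" for i
          using c that f(2)[OF that] unfolding bij_betw_def by (auto simp: prod_alg_simps)
        have "F ?a = c"
          using c ci by (auto simp: F_def prod_alg_simps fun_eq_iff f_inv_into_f PiE_iff extensional_def)
        moreover have "?a \<in> carrier (prod_alg I A)"
          using ci by (auto simp: prod_alg_simps inv_into_into)
        ultimately show "c \<in> F ` carrier (prod_alg I A)" by (rule rev_image_eqI[OF _ sym, rotated])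
      qed
    qed
  qed
  moreover have "prec (prod_alg I A) a b \<longleftrightarrow> prec (prod_alg I C) (F a) (F b)"
    if "a \<in> carrier (prod_alg I A)" "b \<in> carrier (prod_alg I A)" for a b
    using that f(3) by (auto simp: prod_alg_simps F_def PiE_iff)
  ultimately show ?thesis unfolding sub_iso_def by blast
qed

lemma sub_iso_copy:
  assumes A: "subordination_alg A" and f: "inj_on f (carrier A)"
  obtains C where "subordination_alg C" "carrier C = f ` carrier A" "sub_iso C A"
proof -
  define g where "g = inv_into (carrier A) f"
  define C where "C = \<lparr>carrier = f ` carrier A, meet = (\<lambda>x y. f (meet A (g x) (g y))),
    join = (\<lambda>x y. f (join A (g x) (g y))), neg = (\<lambda>x. f (neg A (g x))),
    bzero = f (bzero A), bone = f (bone A), prec = (\<lambda>x y. prec A (g x) (g y))\<rparr>"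
  note cl = ba_closed[OF subordination_alg_boolean[OF A]]
  have gf: "\<And>a. a \<in> carrier A \<Longrightarrow> g (f a) = a" unfolding g_def using f by simp
  have h: "boolean_hom C A g"
    unfolding boolean_hom_def C_def by (auto simp: gf cl)
  have bij: "bij_betw g (carrier C) (carrier A)"
    unfolding g_def C_def using f by (simp add: bij_betw_inv_into inj_on_imp_bij_betw)
  have "subordination_alg C"
  proof (rule subordination_alg_joint_embedding[where I = "UNIV :: unit set" and A = "\<lambda>_. A" and g = "\<lambda>_. g"])
    show "boolean_subuniverse C (carrier C)"
      unfolding boolean_subuniverse_def C_def by (auto simp: gf cl)
    show "a = b" if "a \<in> carrier C" "b \<in> carrier C" "\<And>i :: unit. i \<in> UNIV \<Longrightarrow> g a = g b" for a b
      using that bij by (auto simp: bij_betw_def dest: inj_onD)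
  qed (use A h in \<open>auto simp: C_def\<close>)
  moreover have "sub_iso C A"
    unfolding sub_iso_def using h bij by (intro exI[of _ g]) (auto simp: C_def)
  ultimately show thesis using that by (simp add: C_def)
qed

section \<open>Sizes\<close>

instance fm :: countable
  by countable_datatype

lemma small_lepoll: "small U B \<Longrightarrow> A \<lesssim> B \<Longrightarrow> small U A"
  unfolding small_def by (rule lesspoll_trans1)

text \<open>Gives access to the cardinal arithmetic of infinite sums, used in
  \<open>small_Plus\<close>.\<close>

lemma small_iff_ordLess:
  includes cardinal_syntax
  shows "small (U :: 'u itself) A \<longleftrightarrow> |A| <o |UNIV :: 'u set|"
proof -
  have "A \<prec> (UNIV :: 'u set) \<longleftrightarrow> \<not> (UNIV :: 'u set) \<lesssim> A"
    unfolding lesspoll_def using lepoll_antisym lepoll_trans2 eqpoll_sym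
    by (metis eqpoll_imp_lepoll card_of_ordLeq lepoll_def ordLeq_total card_of_Well_order)
  then show ?thesis
    unfolding small_def lepoll_def using card_of_ordLess by blast
qed

context
  fixes U :: "'u itself"
  assumes U: "is_universe U"
begin

lemma infinite_universe: "infinite (UNIV :: 'u set)"
  using U infinite_le_lepoll unfolding is_universe_def small_def lesspoll_def by blast

lemma small_Plus: "small U A \<Longrightarrow> small U B \<Longrightarrow> small U (A <+> B)"
  unfolding small_iff_ordLess using card_of_Plus_ordLess_infinite[OF infinite_universe] by blast

text \<open>\<open>is_universe\<close> speaks about subsets of \<open>'u\<close> only; a small set
  on another type is first injected into \<open>'u\<close>.\<close>

lemma small_Pow:
  assumes "small U A"
  shows "small U (Pow A)"
proof -
  obtain f :: "'a \<Rightarrow> 'u" where f: "inj_on f A"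
    using assms unfolding small_def lesspoll_def lepoll_def by auto
  then have "small U (f ` A)" using small_lepoll[OF assms image_lepoll] by blast
  then have "small U (Pow (f ` A))" using U unfolding is_universe_def by blast
  moreover have "Pow A \<lesssim> Pow (f ` A)"
    unfolding lepoll_def using inj_on_image_Pow[OF f] by (intro exI[of _ "image f"]) auto
  ultimately show ?thesis by (rule small_lepoll)
qed

lemma small_Times:
  assumes "small U A" "small U B"
  shows "small U (A \<times> B)"
proof (rule small_lepoll[OF small_Pow[OF small_Plus[OF assms]]])
  \<comment> \<open>Coding a pair as a two-element subset of the disjoint sum bounds the product by
    a power set.\<close>
  have "inj_on (\<lambda>(a, b). {Inl a, Inr b}) (A \<times> B)"
    by (rule inj_onI) (auto simp: doubleton_eq_iff)
  then show "A \<times> B \<lesssim> Pow (A <+> B)"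
    unfolding lepoll_def by (intro exI[of _ "\<lambda>(a, b). {Inl a, Inr b}"]) auto
qed

lemma small_countable: "countable A \<Longrightarrow> small U A"
  using U small_lepoll[of U "UNIV :: nat set" A] unfolding is_universe_def countable_def lepoll_def
  by blast

text \<open>A valuation is coded by its graph, a subset of the naturals times
  \<open>G\<close>.\<close>

lemma small_valuations:
  assumes "small U G"
  shows "small U {g :: nat \<Rightarrow> 'b. range g \<subseteq> G}"
proof (rule small_lepoll[OF small_Pow[OF small_Times[OF small_countable assms]]])
  show "countable (UNIV :: nat set)" by simp
  let ?F = "\<lambda>g :: nat \<Rightarrow> 'b. range (\<lambda>n. (n, g n))"
  have "inj_on ?F {g :: nat \<Rightarrow> 'b. range g \<subseteq> G}"
    by (rule inj_onI) (auto simp: fun_eq_iff set_eq_iff image_iff)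
  then show "{g :: nat \<Rightarrow> 'b. range g \<subseteq> G} \<lesssim> Pow ((UNIV :: nat set) \<times> G)"
    unfolding lepoll_def by (intro exI[of _ ?F]) auto
qed

text \<open>Enumerating each factor turns a choice function into a graph inside \<open>I\<close>
  times the naturals. Countability of the factors thereby replaces regularity of the
  universe.\<close>

lemma small_PiE_countable:
  assumes I: "small U I" and X: "\<And>i. i \<in> I \<Longrightarrow> countable (X i)"
  shows "small U (PiE I X)"
proof (rule small_lepoll[OF small_Pow[OF small_Times[OF I small_countable]]])
  show "countable (UNIV :: nat set)" by simp
  let ?F = "\<lambda>f. (\<lambda>i. (i, to_nat_on (X i) (f i))) ` I"
  have "inj_on ?F (PiE I X)"
  proof (rule inj_onI)
    fix f g assume fg: "f \<in> PiE I X" "g \<in> PiE I X" "?F f = ?F g"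
    have "f i = g i" if i: "i \<in> I" for i
    proof -
      have "to_nat_on (X i) (f i) = to_nat_on (X i) (g i)" using fg(3) i by (auto simp: set_eq_iff image_iff)
      then show ?thesis using fg(1,2) i by (auto dest!: inj_onD[OF inj_on_to_nat_on[OF X[OF i]]])
    qed
    then show "f = g" using fg by (intro PiE_ext)
  qed
  then show "PiE I X \<lesssim> Pow (I \<times> (UNIV :: nat set))"
    unfolding lepoll_def by (intro exI[of _ ?F]) auto
qed

text \<open>The modalisation consists of sets of ultrafilters, hence has at most a double power set
  of elements.\<close>

lemma small_modalisation:
  assumes "small U (carrier B)" "boolean_alg B"
  shows "small U (carrier (modalisation B))"
proof (rule small_lepoll[OF small_Pow[OF small_Pow[OF assms(1)]]])
  have "carrier (modalisation B) \<subseteq> Pow (Pow (carrier B))"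
  proof -
    have "carrier (modm B) \<subseteq> Pow (Ult B)" by (rule carrier_modm_subset)
    also have "\<dots> \<subseteq> Pow (Pow (carrier B))" unfolding Ult_def by auto
    finally show ?thesis by (simp add: modalisation_eq[OF assms(2)])
  qed
  then show "carrier (modalisation B) \<lesssim> Pow (Pow (carrier B))" by (rule subset_imp_lepoll)
qed

end

section \<open>Closure conditions up to isomorphism\<close>

lemma small_copy:
  assumes A: "subordination_alg A" and s: "small TYPE('u) (carrier A)"
  obtains C where "C \<in> (SubAlg :: 'u subord set)" "sub_iso C A"
proof -
  obtain f :: "'a \<Rightarrow> 'u" where f: "inj_on f (carrier A)"
    using s unfolding small_def lesspoll_def lepoll_def by auto
  obtain C where C: "subordination_alg C" "carrier C = f ` carrier A" "sub_iso C A"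
    by (rule sub_iso_copy[OF A f])
  have "small TYPE('u) (carrier C)"
    unfolding C(2) by (rule small_lepoll[OF s image_lepoll])
  then show thesis using that C unfolding SubAlg_def by blast
qed

lemma sub_morphism_comp:
  assumes D: "boolean_alg D" and f: "sub_morphism B C f" and g: "sub_morphism C D g"
  shows "sub_morphism B D (g \<circ> f)"
proof -
  have h: "boolean_hom B C f" "boolean_hom C D g" using f g unfolding sub_morphism_def by auto
  have fc: "\<And>a. a \<in> carrier B \<Longrightarrow> f a \<in> carrier C" and gc: "\<And>a. a \<in> carrier C \<Longrightarrow> g a \<in> carrier D"
    using h unfolding boolean_hom_def by auto
  have "\<exists>b\<in>carrier B. prec B a b \<and> ble D (g (f b)) d"
    if a: "a \<in> carrier B" and d: "d \<in> carrier D" "prec D (g (f a)) d" for a d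
  proof -
    obtain c where c: "c \<in> carrier C" "prec C (f a) c" "ble D (g c) d"
      using g fc[OF a] d unfolding sub_morphism_def by blast
    then obtain b where b: "b \<in> carrier B" "prec B a b" "ble C (f b) c"
      using f a unfolding sub_morphism_def by blast
    have "ble D (g (f b)) (g c)" using boolean_hom_ble[OF h(2)] b c fc by blast
    then have "ble D (g (f b)) d" using ble_trans[OF D _ c(3)] b c d fc gc by blast
    then show ?thesis using b by blast
  qed
  moreover have "prec D (g (f a)) (g (f b))"
    if "a \<in> carrier B" "b \<in> carrier B" "prec B a b" for a b
    using f g fc that unfolding sub_morphism_def by blast
  ultimately show ?thesis unfolding sub_morphism_def using boolean_hom_comp[OF h] by simp
qed

lemma morphic_image_trans:
  assumes "boolean_alg D" "morphic_image B C" "morphic_image C D"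
  shows "morphic_image B D"
proof -
  obtain f g where "sub_morphism B C f" "f ` carrier B = carrier C"
    "sub_morphism C D g" "g ` carrier C = carrier D"
    using assms unfolding morphic_image_def by blast
  then show ?thesis
    unfolding morphic_image_def using sub_morphism_comp[OF assms(1)] by (metis image_comp)
qed

lemma subordination_alg_carrier_update:
  assumes B: "subordination_alg B" and S: "boolean_subuniverse B S"
  shows "subordination_alg (B\<lparr>carrier := S\<rparr>)"
proof (rule subordination_alg_joint_embedding[where I = "UNIV :: unit set" and A = "\<lambda>_. B" and g = "\<lambda>_ a. a"])
  show "boolean_hom (B\<lparr>carrier := S\<rparr>) B (\<lambda>a. a)"
    using S unfolding boolean_subuniverse_def boolean_hom_def carrier_update_simps by auto
  show "boolean_subuniverse (B\<lparr>carrier := S\<rparr>) (carrier (B\<lparr>carrier := S\<rparr>))"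
    using S unfolding boolean_subuniverse_def carrier_update_simps by blast
qed (use B in auto)

lemma sub_morphism_inclusion:
  assumes "sub_subuniverse B S"
  shows "sub_morphism (B\<lparr>carrier := S\<rparr>) B (\<lambda>a. a)"
  using assms unfolding sub_subuniverse_def boolean_subuniverse_def sub_morphism_def boolean_hom_def
  by auto

lemma sub_subuniverse_of_modal:
  assumes "modal_alg M" "modal_subuniverse M S"
  shows "sub_subuniverse (sub_of_modal M) S"
proof -
  have "boolean_subuniverse M S" and d: "\<And>a. a \<in> S \<Longrightarrow> dia M a \<in> S"
    using assms(2) unfolding modal_subuniverse_def by auto
  moreover from this have "\<And>a. a \<in> S \<Longrightarrow> a \<in> carrier M" unfolding boolean_subuniverse_def by auto
  ultimately show ?thesis
    unfolding sub_subuniverse_def boolean_subuniverse_def sub_of_modal_simps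
    using ble_refl[OF modal_alg_boolean[OF assms(1)]] by blast
qed

lemma SubAlgD: "B \<in> SubAlg \<Longrightarrow> subordination_alg B" "B \<in> SubAlg \<Longrightarrow> boolean_alg B"
  by (auto simp: SubAlg_def subordination_alg_boolean)

section \<open>Closure conditions transported along isomorphic copies\<close>

context
  fixes K :: "'u subord set"
  assumes K: "K \<subseteq> SubAlg"
begin

lemma belongs_self: "B \<in> K \<Longrightarrow> belongs B K"
  unfolding belongs_def using sub_iso_refl by blast

text \<open>\<open>C\<close> may live on any type; being the image of a small algebra, it has a copy
  on \<open>'u\<close> to which closure of \<open>K\<close> applies.\<close>

lemma belongs_morphic_image:
  assumes cl: "closed_morphic_images K" and A: "belongs A K" "boolean_alg A" and AC: "morphic_image A C"
    and C: "subordination_alg C"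
  shows "belongs C K"
proof -
  obtain D where D: "D \<in> K" "sub_iso D A" using A unfolding belongs_def by auto
  have DC: "morphic_image D C"
    by (rule morphic_image_trans[OF subordination_alg_boolean[OF C] sub_iso_morphic_image[OF D(2) A(2)] AC])
  then have "carrier C \<lesssim> carrier D" unfolding morphic_image_def using image_lepoll by metis
  moreover have "small TYPE('u) (carrier D)" using D K unfolding SubAlg_def by auto
  ultimately obtain C' where C': "C' \<in> (SubAlg :: 'u subord set)" "sub_iso C' C"
    using small_copy[OF C] small_lepoll by blast
  have "morphic_image D C'"
    by (rule morphic_image_trans[OF SubAlgD(2)[OF C'(1)] DC
          sub_iso_morphic_image[OF sub_iso_sym[OF SubAlgD(2)[OF C'(1)] C'(2)] SubAlgD(2)[OF C'(1)]]])
  then show ?thesis using cl D(1) C' unfolding closed_morphic_images_def belongs_def by blast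
qed

lemma belongs_iso:
  assumes "closed_morphic_images K" "belongs A K" "boolean_alg A" "sub_iso A C" "subordination_alg C"
  shows "belongs C K"
  using assms belongs_morphic_image sub_iso_morphic_image subordination_alg_boolean by blast

lemma belongs_subalgebra:
  assumes cl: "closed_subalgebras K" and A: "belongs A K" "boolean_alg A" and S: "sub_subuniverse A S"
  shows "belongs (A\<lparr>carrier := S\<rparr>) K"
proof -
  obtain D where D: "D \<in> K" "sub_iso D A" using A unfolding belongs_def by auto
  note DA = SubAlgD(2)[OF subsetD[OF K D(1)]]
  obtain f where f: "boolean_hom D A f" "bij_betw f (carrier D) (carrier A)"
    "\<And>a b. a \<in> carrier D \<Longrightarrow> b \<in> carrier D \<Longrightarrow> prec D a b \<longleftrightarrow> prec A (f a) (f b)"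
    using D(2) unfolding sub_iso_def by auto
  have fc: "\<And>a. a \<in> carrier D \<Longrightarrow> f a \<in> carrier A" using f(2) by (auto dest: bij_betwE)
  have fh: "f (bzero D) = bzero A" "f (bone D) = bone A"
    "\<And>a. a \<in> carrier D \<Longrightarrow> f (neg D a) = neg A (f a)"
    "\<And>a b. a \<in> carrier D \<Longrightarrow> b \<in> carrier D \<Longrightarrow> f (meet D a b) = meet A (f a) (f b)"
    "\<And>a b. a \<in> carrier D \<Longrightarrow> b \<in> carrier D \<Longrightarrow> f (join D a b) = join A (f a) (f b)"
    using f(1) unfolding boolean_hom_def by auto
  have le: "ble D a b \<longleftrightarrow> ble A (f a) (f b)" if "a \<in> carrier D" "b \<in> carrier D" for a b
    using that fh(4) ba_closed(4)[OF DA] inj_on_eq_iff[OF bij_betw_imp_inj_on[OF f(2)]]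
    unfolding ble_def by metis
  \<comment> \<open>Closure under subalgebras applies only to the member \<open>D\<close> of
    \<open>K\<close>, so \<open>S\<close> is pulled back along the isomorphism.\<close>
  define T where "T = {a \<in> carrier D. f a \<in> S}"
  have SA: "S \<subseteq> carrier A" and Sb: "boolean_subuniverse A S"
    using S unfolding sub_subuniverse_def boolean_subuniverse_def by auto
  have T: "boolean_subuniverse D T"
    using Sb ba_closed[OF DA] unfolding boolean_subuniverse_def T_def by (auto simp: fh)
  have fT: "f ` T = S"
    using SA f(2) unfolding T_def bij_betw_def by auto
  have "\<exists>c\<in>T. prec D a c \<and> ble D c b" if a: "a \<in> T" and b: "b \<in> carrier D" "prec D a b" for a b
  proof -
    have a': "a \<in> carrier D" "f a \<in> S" using a unfolding T_def by auto
    then have "prec A (f a) (f b)" using f(3) b by blast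
    then obtain c where c: "c \<in> S" "prec A (f a) c" "ble A c (f b)"
      using S a' fc[OF b(1)] unfolding sub_subuniverse_def by blast
    then obtain e where "e \<in> T" "c = f e" using fT by auto
    then show ?thesis using c f(3)[of a e] le[of e b] a' b unfolding T_def by auto
  qed
  then have "sub_subuniverse D T" unfolding sub_subuniverse_def using T by blast
  then have "D\<lparr>carrier := T\<rparr> \<in> K" using cl D(1) unfolding closed_subalgebras_def by blast
  moreover have "sub_iso (D\<lparr>carrier := T\<rparr>) (A\<lparr>carrier := S\<rparr>)"
    unfolding sub_iso_def
  proof (intro exI[of _ f] conjI)
    show "boolean_hom (D\<lparr>carrier := T\<rparr>) (A\<lparr>carrier := S\<rparr>) f"
      unfolding boolean_hom_def carrier_update_simps by (auto simp: T_def fh)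
    show "bij_betw f (carrier (D\<lparr>carrier := T\<rparr>)) (carrier (A\<lparr>carrier := S\<rparr>))"
      using f(2) fT unfolding bij_betw_def T_def by (auto intro: inj_on_subset)
  qed (use f(3) in \<open>auto simp: T_def\<close>)
  ultimately show ?thesis unfolding belongs_def by blast
qed

end

section \<open>Schemes and normal logics\<close>

definition scheme_class :: "fm set \<Rightarrow> 'u subord set" where
  "scheme_class \<Gamma> = {B \<in> SubAlg. \<forall>\<phi>\<in>\<Gamma>. \<forall>\<sigma>. valid B (subst \<sigma> \<phi>)}"

text \<open>The other half of a Galois connection with \<open>scheme_class\<close>. All instances
  are required because \<open>valid\<close> tests only valuations coming from elements of
  \<open>B\<close>, and so need not be closed under substitution.\<close>

definition scheme_logic :: "'u subord set \<Rightarrow> fm set" where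
  "scheme_logic K = {\<phi>. \<forall>B\<in>K. \<forall>\<sigma>. valid B (subst \<sigma> \<phi>)}"

lemma scheme_class_subset: "scheme_class \<Gamma> \<subseteq> SubAlg"
  by (auto simp: scheme_class_def)

lemma subset_scheme_class: "K \<subseteq> SubAlg \<Longrightarrow> K \<subseteq> scheme_class (scheme_logic K)"
  by (auto simp: scheme_class_def scheme_logic_def)

text \<open>Through \<open>valid_schemes_iff\<close> this becomes the logic of the modal algebras
  \<open>modm B\<close>, where each clause is a computation with sets of ultrafilters.\<close>

lemma normal_modal_logic_scheme_logic:
  assumes K: "K \<subseteq> SubAlg"
  shows "normal_modal_logic (scheme_logic K)"
proof -
  have L: "scheme_logic K = {\<phi>. \<forall>B\<in>K. mvalid (modm B) \<phi>}"
    by (simp add: scheme_logic_def valid_schemes_iff)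
  have val: "range u \<subseteq> Pow (Ult B)" if "B \<in> K" "range u \<subseteq> carrier (modm B)" for B u
    using that carrier_modm_subset[of B] by blast
  have taut: "interp (delta B) u \<phi> = Ult B" if "tautology \<phi>" "range u \<subseteq> Pow (Ult B)"
    for \<phi> u and B :: "'a subord"
    using that in_interp_delta_iff_ptrue[OF _ that(2), of _ \<phi>]
      interp_closed[OF modal_alg_delta, of u B \<phi>] unfolding tautology_def by auto
  show ?thesis
    unfolding normal_modal_logic_def L
  proof (intro conjI allI impI)
    fix \<phi> assume "tautology \<phi>"
    then show "\<phi> \<in> {\<phi>. \<forall>B\<in>K. mvalid (modm B) \<phi>}"
      unfolding mem_Collect_eq mvalid_def modm_simps(2,3)
      by (intro ballI allI impI) (rule taut[OF _ val])
  next
    fix \<phi> \<sigma> assume "\<phi> \<in> {\<phi>. \<forall>B\<in>K. mvalid (modm B) \<phi>}"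
    then show "subst \<sigma> \<phi> \<in> {\<phi>. \<forall>B\<in>K. mvalid (modm B) \<phi>}"
      using mvalid_subst[OF modal_alg_modm[OF SubAlgD(2)[OF subsetD[OF K]]]] by simp
  next
    fix \<phi> \<psi> assume *: "\<phi> \<in> {\<phi>. \<forall>B\<in>K. mvalid (modm B) \<phi>}"
      "Imp \<phi> \<psi> \<in> {\<phi>. \<forall>B\<in>K. mvalid (modm B) \<phi>}"
    show "\<psi> \<in> {\<phi>. \<forall>B\<in>K. mvalid (modm B) \<phi>}"
      using * by (auto simp: mvalid_def)
  next
    fix \<phi> assume *: "\<phi> \<in> {\<phi>. \<forall>B\<in>K. mvalid (modm B) \<phi>}"
    then show "Box \<phi> \<in> {\<phi>. \<forall>B\<in>K. mvalid (modm B) \<phi>}"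
      by (simp add: mvalid_def)
  next
    have "interp (delta B) u (Imp (Box (Imp (Var 0) (Var 1))) (Imp (Box (Var 0)) (Box (Var 1)))) = Ult B"
      for u and B :: "'a subord"
      by auto
    then show "Imp (Box (Imp (Var 0) (Var 1))) (Imp (Box (Var 0)) (Box (Var 1)))
        \<in> {\<phi>. \<forall>B\<in>K. mvalid (modm B) \<phi>}"
      unfolding mem_Collect_eq mvalid_def modm_simps(2,3) by (intro ballI allI impI)
  next
    \<comment> \<open>Here a double complement has to cancel, so the value of the variable must lie
      inside \<open>Ult B\<close>.\<close>
    have dual: "interp (delta B) u (Iff (Dia (Var 0)) (Neg (Box (Neg (Var 0))))) = Ult B"
      if "range u \<subseteq> Pow (Ult B)" for u and B :: "'a subord"
    proof -
      have "Ult B - (Ult B - u 0) = u 0" using that by auto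
      then show ?thesis by auto
    qed
    show "Iff (Dia (Var 0)) (Neg (Box (Neg (Var 0)))) \<in> {\<phi>. \<forall>B\<in>K. mvalid (modm B) \<phi>}"
      unfolding mem_Collect_eq mvalid_def modm_simps(2,3)
      by (intro ballI allI impI) (rule dual[OF val])
  qed
qed

lemma definable_by_schemes_iff: "definable_by_schemes K \<longleftrightarrow> (\<exists>\<Gamma>. K = scheme_class \<Gamma>)"
  by (simp add: definable_by_schemes_def scheme_class_def)

lemma scheme_class_scheme_logic:
  assumes "K = scheme_class \<Gamma>"
  shows "K = scheme_class (scheme_logic K)"
proof
  show "K \<subseteq> scheme_class (scheme_logic K)"
    using assms scheme_class_subset subset_scheme_class by blast
  show "scheme_class (scheme_logic K) \<subseteq> K"
    using assms unfolding scheme_class_def scheme_logic_def by blast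
qed

lemma Mod_eq_scheme_class:
  assumes "normal_modal_logic L"
  shows "Mod L = scheme_class L"
proof -
  have "subst \<sigma> \<phi> \<in> L" if "\<phi> \<in> L" for \<sigma> \<phi>
    using assms that unfolding normal_modal_logic_def by blast
  then show ?thesis unfolding Mod_def scheme_class_def by (auto; metis subst_Var)
qed

lemma Mod_iff_definable_by_schemes:
  "(\<exists>L. normal_modal_logic L \<and> K = Mod L) \<longleftrightarrow> definable_by_schemes K"
proof
  assume "\<exists>L. normal_modal_logic L \<and> K = Mod L"
  then show "definable_by_schemes K"
    unfolding definable_by_schemes_iff using Mod_eq_scheme_class by blast
next
  assume "definable_by_schemes K"
  then obtain \<Gamma> where \<Gamma>: "K = scheme_class \<Gamma>" unfolding definable_by_schemes_iff by blast
  have "normal_modal_logic (scheme_logic K)"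
    by (rule normal_modal_logic_scheme_logic) (simp add: \<Gamma> scheme_class_subset)
  then show "\<exists>L. normal_modal_logic L \<and> K = Mod L"
    using scheme_class_scheme_logic[OF \<Gamma>] Mod_eq_scheme_class by blast
qed

section \<open>Closure properties of scheme classes\<close>

lemma belongs_scheme_classI:
  assumes A: "subordination_alg A" and s: "small TYPE('u) (carrier A)"
    and v: "\<And>\<phi> \<sigma>. \<phi> \<in> \<Gamma> \<Longrightarrow> valid A (subst \<sigma> \<phi>)"
  shows "belongs A (scheme_class \<Gamma> :: 'u subord set)"
proof -
  obtain C where C: "C \<in> (SubAlg :: 'u subord set)" "sub_iso C A" by (rule small_copy[OF A s])
  then have "C \<in> scheme_class \<Gamma>"
    using v sub_iso_valid[OF C(2) SubAlgD(1)[OF C(1)] A] unfolding scheme_class_def by blast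
  then show ?thesis using C unfolding belongs_def by blast
qed

lemma belongs_scheme_classD:
  assumes "belongs A (scheme_class \<Gamma> :: 'u subord set)" "subordination_alg A" "\<phi> \<in> \<Gamma>"
  shows "valid A (subst \<sigma> \<phi>)"
proof -
  obtain C :: "'u subord" where C: "C \<in> scheme_class \<Gamma>" "sub_iso C A" using assms(1) unfolding belongs_def by blast
  then have "subordination_alg C" "valid C (subst \<sigma> \<phi>)"
    using assms(3) unfolding scheme_class_def by (auto dest: SubAlgD)
  then show ?thesis using sub_iso_valid[OF C(2)] assms(2) by blast
qed

text \<open>Coordinatewise the map is the dual of a projection, which makes the results on dual maps
  applicable.\<close>

lemma good_map_eq:
  "good_map J A E = (\<lambda>j\<in>J. dual_map (prod_alg J A) (A j) (\<lambda>a. a j) E)"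
  by (simp add: good_map_def dual_map_def ult_vimage_def)

text \<open>The value of \<phi> and the top element both lie in the modalisation of the product and
  both become top in every coordinate; goodness makes them equal.\<close>

lemma valid_good_product:
  assumes A: "\<And>j. j \<in> J \<Longrightarrow> subordination_alg (A j)" and good: "good_family J A"
    and val: "\<And>j. j \<in> J \<Longrightarrow> valid (A j) \<phi>"
  shows "valid (prod_alg J A) \<phi>"
  unfolding valid_alt
proof (intro allI impI)
  let ?P = "prod_alg J A"
  have P: "subordination_alg ?P" by (rule subordination_alg_prod[OF A])
  note PA = subordination_alg_boolean[OF P] and pr = prod_alg_projection_morphism[of J A, OF A]
  fix v :: "nat \<Rightarrow> _" assume v: "range v \<subseteq> carrier ?P"
  let ?E = "interp (delta ?P) (ult_rep ?P \<circ> v) \<phi>"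
  have "dual_map ?P (A j) (\<lambda>a. a j) ?E = dual_map ?P (A j) (\<lambda>a. a j) (Ult ?P)" if j: "j \<in> J" for j
  proof -
    have "range ((\<lambda>a. a j) \<circ> v) \<subseteq> carrier (A j)" using v pr(2)[OF _ j] by (auto simp: image_subset_iff)
    then have "dual_map ?P (A j) (\<lambda>a. a j) ?E = Ult (A j)"
      using dual_map_interp[OF P A[OF j] pr(1)[OF _ j] v] val[OF j] unfolding valid_alt by simp
    moreover have "dual_map ?P (A j) (\<lambda>a. a j) (Ult ?P) = Ult (A j)"
      using dual_map_modal_hom[OF P A[OF j] pr(1)[OF _ j]]
      unfolding modal_hom_def boolean_hom_def by simp
    ultimately show ?thesis by simp
  qed
  then have "good_map J A ?E = good_map J A (Ult ?P)" by (auto simp: good_map_eq fun_eq_iff)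
  moreover have "?E \<in> carrier (modalisation ?P)"
    unfolding modalisation_eq[OF PA] sub_of_modal_simps by (rule interp_ult_rep_in_modm[OF v])
  moreover have "Ult ?P \<in> carrier (modalisation ?P)"
    using ba_closed(2)[OF modal_alg_boolean[OF modal_alg_modm[OF PA]]]
    by (simp add: modalisation_eq[OF PA])
  ultimately show "?E = Ult ?P" using good unfolding good_family_def by (auto dest: inj_onD)
qed

lemma scheme_class_closed:
  assumes U: "is_universe TYPE('u)" and K: "K = (scheme_class \<Gamma> :: 'u subord set)"
  shows "closed_subalgebras K" "closed_morphic_images K" "closed_good_products K"
    "closed_modalisation K" "reflects_modalisation K"
proof -
  have KS: "K \<subseteq> SubAlg" using K scheme_class_subset by blast
  have sub: "\<And>B. B \<in> K \<Longrightarrow> subordination_alg B" and ba: "\<And>B. B \<in> K \<Longrightarrow> boolean_alg B"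
    and sm: "\<And>B. B \<in> K \<Longrightarrow> small TYPE('u) (carrier B)"
    and val: "\<And>B \<phi> \<sigma>. B \<in> K \<Longrightarrow> \<phi> \<in> \<Gamma> \<Longrightarrow> valid B (subst \<sigma> \<phi>)"
    using KS SubAlgD unfolding K by (auto simp: scheme_class_def SubAlg_def)
  show "closed_subalgebras K"
    unfolding closed_subalgebras_def
  proof (intro ballI allI impI)
    fix B :: "'u subord" and S assume B: "B \<in> K" and S: "sub_subuniverse B S"
    have S': "boolean_subuniverse B S" using S unfolding sub_subuniverse_def by blast
    have sB: "subordination_alg (B\<lparr>carrier := S\<rparr>)"
      by (rule subordination_alg_carrier_update[OF sub[OF B] S'])
    have "S \<lesssim> carrier B" using S' subset_imp_lepoll unfolding boolean_subuniverse_def by blast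
    then have "small TYPE('u) S" by (rule small_lepoll[OF sm[OF B]])
    moreover have "valid (B\<lparr>carrier := S\<rparr>) (subst \<sigma> \<phi>)" if "\<phi> \<in> \<Gamma>" for \<phi> \<sigma>
      by (rule valid_inj_reflect[OF sB sub[OF B] sub_morphism_inclusion[OF S] _ val[OF B that]]) simp
    ultimately show "B\<lparr>carrier := S\<rparr> \<in> K" using sB unfolding K scheme_class_def SubAlg_def by simp
  qed
  show "closed_morphic_images K"
    unfolding closed_morphic_images_def
  proof (intro ballI impI)
    fix B C :: "'u subord" assume B: "B \<in> K" and C: "C \<in> SubAlg" and BC: "morphic_image B C"
    then obtain f where f: "sub_morphism B C f" "f ` carrier B = carrier C"
      unfolding morphic_image_def by blast
    have "valid C (subst \<sigma> \<phi>)" if "\<phi> \<in> \<Gamma>" for \<phi> \<sigma>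
      by (rule valid_surj_image[OF sub[OF B] SubAlgD(1)[OF C] f val[OF B that]])
    then show "C \<in> K" using C unfolding K scheme_class_def by simp
  qed
  show "closed_good_products K"
    unfolding closed_good_products_def
  proof (intro allI impI)
    fix J :: "'u set" and A :: "'u \<Rightarrow> 'u subord"
    assume A: "\<forall>j\<in>J. A j \<in> K" and good: "good_family J A"
      and s: "small TYPE('u) (carrier (prod_alg J A))"
    show "belongs (prod_alg J A) K"
      unfolding K
      by (intro belongs_scheme_classI subordination_alg_prod s valid_good_product good)
        (use A sub val in blast)+
  qed
  show "closed_modalisation K"
    unfolding closed_modalisation_def
  proof
    fix B assume B: "B \<in> K"
    show "belongs (modalisation B) K"
      unfolding K
      by (intro belongs_scheme_classI subordination_alg_modalisation ba[OF B]
          small_modalisation[OF U sm[OF B] ba[OF B]])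
        (use valid_schemes_modalisation[OF ba[OF B]] val[OF B] in blast)
  qed
  show "reflects_modalisation K"
    unfolding reflects_modalisation_def
  proof (intro ballI impI)
    fix B :: "'u subord" assume B: "B \<in> SubAlg" and m: "belongs (modalisation B) K"
    have "valid (modalisation B) (subst \<sigma> \<phi>)" if "\<phi> \<in> \<Gamma>" for \<phi> \<sigma>
      by (rule belongs_scheme_classD[OF m[unfolded K]
            subordination_alg_modalisation[OF SubAlgD(2)[OF B]] that])
    then show "B \<in> K"
      using B valid_schemes_modalisation[OF SubAlgD(2)[OF B]] unfolding K scheme_class_def by blast
  qed
qed

section \<open>Products of modalisations\<close>

lemma has_dia_modalisation: "boolean_alg B \<Longrightarrow> has_dia (modalisation B)"
  by (simp add: modalisation_eq has_dia_sub_of_modal modal_alg_modm)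

text \<open>The product has a diamond again, so its modalisation contains only the sets
  \<open>ult_rep ?P a\<close>. On these the good map reads off the coordinates of \<open>a\<close>,
  up to the injective \<open>ult_rep\<close> of each factor.\<close>

lemma good_family_has_dia:
  assumes A: "\<And>j. j \<in> J \<Longrightarrow> subordination_alg (A j)" and d: "\<And>j. j \<in> J \<Longrightarrow> has_dia (A j)"
  shows "good_family J A"
proof -
  let ?P = "prod_alg J A"
  have P: "subordination_alg ?P" by (rule subordination_alg_prod[OF A])
  note pr = prod_alg_projection_morphism[of J A, OF A]
  have car: "carrier (modalisation ?P) = ult_rep ?P ` carrier ?P"
    using carrier_modm_has_dia[OF P has_dia_prod[OF d]]
    unfolding modalisation_eq[OF subordination_alg_boolean[OF P]] by simp
  have "a = b" if a: "a \<in> carrier ?P" and b: "b \<in> carrier ?P"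
    and eq: "good_map J A (ult_rep ?P a) = good_map J A (ult_rep ?P b)" for a b
  proof -
    have "a j = b j" if j: "j \<in> J" for j
    proof -
      have "ult_rep (A j) (a j) = ult_rep (A j) (b j)"
        using fun_cong[OF eq, of j] j dual_map_ult_rep[OF P A[OF j] pr(1)[OF _ j]] a b
        by (simp add: good_map_eq)
      moreover have "a j \<in> carrier (A j)" "b j \<in> carrier (A j)"
        using a b j by (auto simp: prod_alg_simps)
      ultimately show ?thesis
        using ult_rep_inj[OF subordination_alg_boolean[OF A[OF j]]] by (auto dest: inj_onD)
    qed
    then show ?thesis using a b by (auto simp: prod_alg_simps intro: PiE_ext)
  qed
  then show ?thesis unfolding good_family_def car inj_on_def by blast
qed

lemma closed_imp_modalised_products_condition:
  assumes KS: "K \<subseteq> (SubAlg :: 'u subord set)" and cm: "closed_morphic_images K"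
    and cg: "closed_good_products K" and cmod: "closed_modalisation K" and rm: "reflects_modalisation K"
  shows "modalised_products_condition K"
  unfolding modalised_products_condition_def
proof (intro allI impI)
  fix I :: "'u set" and B :: "'u \<Rightarrow> 'u subord"
  let ?N = "\<lambda>i. modalisation (B i)" and ?P = "prod_alg I (\<lambda>i. modalisation (B i))"
  assume I: "small TYPE('u) I" and B: "\<forall>i\<in>I. B i \<in> SubAlg" and s: "small TYPE('u) (carrier ?P)"
  have N: "subordination_alg (?N i)" "has_dia (?N i)" if "i \<in> I" for i
    using B that SubAlgD(2) by (blast intro: subordination_alg_modalisation has_dia_modalisation)+
  have P: "subordination_alg ?P" by (rule subordination_alg_prod[OF N(1)])
  show "belongs ?P K \<longleftrightarrow> (\<forall>i\<in>I. B i \<in> K)"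
  proof
    assume b: "belongs ?P K"
    show "\<forall>i\<in>I. B i \<in> K"
    proof
      fix i assume i: "i \<in> I"
      have "morphic_image ?P (?N i)"
        unfolding morphic_image_def using prod_alg_projection_morphism[of I ?N, OF N(1) i] by blast
      then have "belongs (?N i) K"
        by (rule belongs_morphic_image[OF KS cm b subordination_alg_boolean[OF P] _ N(1)[OF i]])
      then show "B i \<in> K" using rm B i unfolding reflects_modalisation_def by blast
    qed
  next
    assume "\<forall>i\<in>I. B i \<in> K"
    \<comment> \<open>Good products are formed from members of \<open>K\<close>, so the
      modalisations are replaced by copies, which still have diamonds and therefore form a good
      family.\<close>
    then have "\<forall>i\<in>I. \<exists>C\<in>K. sub_iso C (?N i)"
      using cmod unfolding closed_modalisation_def belongs_def by blast
    then obtain C where C: "\<And>i. i \<in> I \<Longrightarrow> C i \<in> K" "\<And>i. i \<in> I \<Longrightarrow> sub_iso (C i) (?N i)" by metis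
    have CS: "C i \<in> SubAlg" if "i \<in> I" for i using C(1)[OF that] KS by blast
    have iso: "sub_iso (prod_alg I C) ?P" by (rule sub_iso_prod[OF C(2)])
    then obtain f where "bij_betw f (carrier (prod_alg I C)) (carrier ?P)"
      unfolding sub_iso_def by blast
    then have "carrier (prod_alg I C) \<lesssim> carrier ?P"
      by (intro eqpoll_imp_lepoll) (auto simp: eqpoll_def)
    then have "small TYPE('u) (carrier (prod_alg I C))" by (rule small_lepoll[OF s])
    moreover have "good_family I C"
      by (rule good_family_has_dia[OF SubAlgD(1)[OF CS] sub_iso_has_dia[OF C(2) SubAlgD(2)[OF CS] N(2)]])
    ultimately have "belongs (prod_alg I C) K"
      using cg C(1) I unfolding closed_good_products_def by blast
    then show "belongs ?P K"
      by (rule belongs_iso[OF KS cm _ subordination_alg_boolean[OF subordination_alg_prod[OF SubAlgD(1)[OF CS]]] iso P])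
  qed
qed

section \<open>The variety argument\<close>

lemma prod_alg_cong: "(\<And>i. i \<in> I \<Longrightarrow> A i = C i) \<Longrightarrow> prod_alg I A = prod_alg I C"
  by (simp add: prod_alg_def fun_eq_iff restrict_def cong: PiE_cong)

text \<open>\<open>prod_alg\<close> retains only \<open>prec\<close>; the explicit diamond is needed
  to evaluate formulas coordinatewise.\<close>

definition mprod :: "'i set \<Rightarrow> ('i \<Rightarrow> 'a modal) \<Rightarrow> ('i \<Rightarrow> 'a) modal" where
  "mprod I N =
     \<lparr>carrier = (\<Pi>\<^sub>E i\<in>I. carrier (N i)),
      meet = (\<lambda>a b. \<lambda>i\<in>I. meet (N i) (a i) (b i)),
      join = (\<lambda>a b. \<lambda>i\<in>I. join (N i) (a i) (b i)),
      neg = (\<lambda>a. \<lambda>i\<in>I. neg (N i) (a i)),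
      bzero = (\<lambda>i\<in>I. bzero (N i)),
      bone = (\<lambda>i\<in>I. bone (N i)),
      dia = (\<lambda>a. \<lambda>i\<in>I. dia (N i) (a i))\<rparr>"

lemma mprod_simps:
  "carrier (mprod I N) = (\<Pi>\<^sub>E i\<in>I. carrier (N i))"
  "join (mprod I N) a b = (\<lambda>i\<in>I. join (N i) (a i) (b i))"
  "bzero (mprod I N) = (\<lambda>i\<in>I. bzero (N i))"
  "bone (mprod I N) = (\<lambda>i\<in>I. bone (N i))"
  "dia (mprod I N) a = (\<lambda>i\<in>I. dia (N i) (a i))"
  by (simp_all add: mprod_def)

lemma prod_alg_sub_of_modal: "prod_alg I (\<lambda>i. sub_of_modal (N i)) = sub_of_modal (mprod I N)"
  by (auto simp: prod_alg_def mprod_def sub_of_modal_def ble_def fun_eq_iff restrict_def)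

lemma modal_alg_mprod:
  assumes N: "\<And>i. i \<in> I \<Longrightarrow> modal_alg (N i)"
  shows "modal_alg (mprod I N)"
proof -
  have "subordination_alg (sub_of_modal (mprod I N))"
    unfolding prod_alg_sub_of_modal[symmetric]
    by (intro subordination_alg_prod subordination_alg_sub_of_modal N)
  then have "boolean_alg (mprod I N)" using subordination_alg_boolean by force
  moreover have "dia (N i) a \<in> carrier (N i)"
    "b \<in> carrier (N i) \<Longrightarrow> dia (N i) (join (N i) a b) = join (N i) (dia (N i) a) (dia (N i) b)"
    if "i \<in> I" "a \<in> carrier (N i)" for i a b
    using N[OF that(1)] that(2) unfolding modal_alg_def by blast+
  moreover have "dia (N i) (bzero (N i)) = bzero (N i)" if "i \<in> I" for i
    using N[OF that(1)] unfolding modal_alg_def by blast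
  ultimately show ?thesis
    unfolding modal_alg_def by (auto simp: mprod_simps PiE_iff intro!: restrict_ext)
qed

lemma interp_mprod: "i \<in> I \<Longrightarrow> interp (mprod I N) u \<phi> i = interp (N i) (\<lambda>p. u p i) \<phi>"
  by (induction \<phi>) (simp_all add: mprod_def)

text \<open>The products condition for a one-element index set, whose product is isomorphic to its
  only factor. It recovers closure under modalisation and its reflection.\<close>

lemma belongs_modalisation_iff:
  assumes U: "is_universe TYPE('u)" and KS: "K \<subseteq> (SubAlg :: 'u subord set)"
    and cm: "closed_morphic_images K" and mp: "modalised_products_condition K" and B: "B \<in> SubAlg"
  shows "belongs (modalisation B) K \<longleftrightarrow> B \<in> K"
proof -
  let ?I = "{undefined :: 'u}" and ?N = "modalisation B"
  let ?P = "prod_alg ?I (\<lambda>_. modalisation B)" and ?f = "\<lambda>a :: 'u \<Rightarrow> 'u set set. a undefined"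
  have N: "subordination_alg ?N" by (rule subordination_alg_modalisation[OF SubAlgD(2)[OF B]])
  have P: "subordination_alg ?P" by (rule subordination_alg_prod[OF N])
  have bij: "bij_betw ?f (carrier ?P) (carrier ?N)"
    unfolding bij_betw_def
  proof
    show "inj_on ?f (carrier ?P)"
      by (rule inj_onI) (auto simp: prod_alg_simps intro: PiE_ext)
    show "?f ` carrier ?P = carrier ?N"
      using prod_alg_projection_morphism(2)[of ?I "\<lambda>_. ?N" undefined] N by simp
  qed
  have iso: "sub_iso ?P ?N"
    unfolding sub_iso_def
    using bij prod_alg_projection_hom[of undefined ?I "\<lambda>_. ?N"]
    by (intro exI[of _ ?f]) (simp add: prod_alg_simps(7))
  have "belongs ?N K \<longleftrightarrow> belongs ?P K"
    using belongs_iso[OF KS cm _ subordination_alg_boolean[OF P] iso N]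
      belongs_iso[OF KS cm _ subordination_alg_boolean[OF N]
        sub_iso_sym[OF subordination_alg_boolean[OF P] iso] P] by blast
  also have "belongs ?P K \<longleftrightarrow> B \<in> K"
  proof -
    have s: "small TYPE('u) (carrier ?N)"
      using small_modalisation[OF U] B SubAlgD(2)[OF B] unfolding SubAlg_def by blast
    have "carrier ?P \<lesssim> carrier ?N"
      using bij by (intro eqpoll_imp_lepoll) (auto simp: eqpoll_def)
    then have "small TYPE('u) (carrier ?P)" by (rule small_lepoll[OF s])
    moreover have "small TYPE('u) ?I" by (rule small_countable[OF U]) simp
    ultimately have "belongs ?P K \<longleftrightarrow> (\<forall>i\<in>?I. B \<in> K)"
      using mp[unfolded modalised_products_condition_def, rule_format, of ?I "\<lambda>_. B"] B by blast
    then show ?thesis by simp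
  qed
  finally show ?thesis .
qed

text \<open>Loewenheim--Skolem is available only for modal algebras: interpolating \<open>\<prec>\<close> inside a countable
  subalgebra of \<open>D\<close> itself could require uncountably many elements.\<close>

lemma countable_refutation:
  assumes KS: "K \<subseteq> (SubAlg :: 'u subord set)" and cs: "closed_subalgebras K"
    and D: "D \<in> K" "belongs (modalisation D) K" and \<chi>: "\<not> valid D \<chi>"
  obtains C where "C \<in> K" "countable (carrier C)" "has_dia C" "\<not> valid C \<chi>"
proof -
  have DA: "boolean_alg D" using D KS SubAlgD(2) by blast
  obtain v where v: "range v \<subseteq> carrier D" "interp (delta D) (ult_rep D \<circ> v) \<chi> \<noteq> Ult D"
    using \<chi> unfolding valid_alt by blast
  let ?M = "modm D" and ?w = "ult_rep D \<circ> v"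
  \<comment> \<open>The subalgebra generated by the refuting valuation alone. It is countable
    because there are only countably many formulas, and it still refutes \<chi>.\<close>
  let ?T = "range (interp ?M ?w)"
  let ?N = "?M\<lparr>carrier := ?T\<rparr>"
  have M: "modal_alg ?M" by (rule modal_alg_modm[OF DA])
  have w: "range ?w \<subseteq> carrier ?M" using interp_ult_rep_in_modm[OF v(1), of "Var _"] by auto
  have T: "modal_subuniverse ?M ?T" by (rule modal_subuniverse_range_interp[OF M w])
  have N: "modal_alg ?N" by (rule modal_alg_carrier_update[OF M T])
  have wT: "range ?w \<subseteq> ?T"
  proof
    fix E assume "E \<in> range ?w"
    then obtain p where "E = interp ?M ?w (Var p)" by auto
    then show "E \<in> ?T" by blast
  qed
  have "interp ?N ?w \<chi> \<noteq> bone ?N" using v(2) by simp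
  then have "\<not> mvalid ?N \<chi>" using wT unfolding mvalid_def by auto
  then have nv: "\<not> valid (sub_of_modal ?N) \<chi>" using valid_sub_of_modal[OF N] by simp
  have "belongs ((sub_of_modal ?M)\<lparr>carrier := ?T\<rparr>) K"
    using D(2) belongs_subalgebra[OF KS cs _ _ sub_subuniverse_of_modal[OF M T]]
      modal_alg_boolean[OF M] modalisation_eq[OF DA] by simp
  then have "belongs (sub_of_modal ?N) K" by (simp only: sub_of_modal_carrier_update)
  then obtain C where C: "C \<in> K" "sub_iso C (sub_of_modal ?N)" unfolding belongs_def by auto
  have CS: "C \<in> SubAlg" using C KS by blast
  obtain f where "bij_betw f (carrier C) ?T" using C(2) unfolding sub_iso_def by auto
  then have "carrier C \<approx> ?T" by (auto simp: eqpoll_def)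
  then have "countable (carrier C)" by (rule countable_eqpoll[rotated]) simp
  moreover have "has_dia C"
    by (rule sub_iso_has_dia[OF C(2) SubAlgD(2)[OF CS] has_dia_sub_of_modal[OF N]])
  moreover have "\<not> valid C \<chi>"
    using nv sub_iso_valid[OF C(2) SubAlgD(1)[OF CS] subordination_alg_sub_of_modal[OF N]] by simp
  ultimately show thesis using that C(1) by blast
qed

text \<open>Variables with equal values under \<open>g\<close> are identified before the refutation, so that the refuting
  valuation factors through \<open>g\<close>.\<close>

lemma countable_separation:
  assumes U: "is_universe TYPE('u)" and KS: "K \<subseteq> (SubAlg :: 'u subord set)"
    and cs: "closed_subalgebras K" and cm: "closed_morphic_images K"
    and mp: "modalised_products_condition K"
    and M: "\<And>\<phi>. \<phi> \<in> scheme_logic K \<Longrightarrow> mvalid M \<phi>"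
    and g: "range g \<subseteq> carrier M" and \<chi>: "interp M g \<chi> \<noteq> bone M"
  obtains C h where "C \<in> K" "countable (carrier (modalisation C))" "range h \<subseteq> carrier (modm C)"
    "interp (modm C) (\<lambda>p. h (g p)) \<chi> \<noteq> bone (modm C)"
proof -
  define r where "r p = (LEAST q. g q = g p)" for p
  have gr: "g (r p) = g p" for p unfolding r_def by (rule LeastI) simp
  let ?\<chi> = "subst (\<lambda>p. Var (r p)) \<chi>"
  have "interp M g ?\<chi> \<noteq> bone M" using \<chi> by (simp add: interp_subst gr)
  then have "?\<chi> \<notin> scheme_logic K" using M g unfolding mvalid_def by blast
  then obtain D \<sigma> where D: "D \<in> K" "\<not> valid D (subst \<sigma> ?\<chi>)" unfolding scheme_logic_def by auto
  have "belongs (modalisation D) K"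
    using belongs_modalisation_iff[OF U KS cm mp subsetD[OF KS D(1)]] D(1) by simp
  then obtain C where C: "C \<in> K" "countable (carrier C)" "has_dia C" "\<not> valid C (subst \<sigma> ?\<chi>)"
    by (rule countable_refutation[OF KS cs D(1) _ D(2)])
  have CS: "C \<in> SubAlg" using C KS by blast
  have "\<not> mvalid (modm C) ?\<chi>" using C(4) valid_schemes_iff by blast
  then obtain u where u: "range u \<subseteq> carrier (modm C)" "interp (modm C) u ?\<chi> \<noteq> bone (modm C)"
    unfolding mvalid_def by blast
  \<comment> \<open>For \<open>m\<close> outside the range of \<open>g\<close> the chosen variable
    is unspecified, which is harmless: all values of \<open>u\<close> lie in the carrier.\<close>
  let ?h = "\<lambda>m. u (LEAST q. g q = m)"
  have "interp (modm C) (\<lambda>p. ?h (g p)) \<chi> \<noteq> bone (modm C)"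
    using u(2) unfolding interp_subst by (simp add: r_def)
  moreover have "range ?h \<subseteq> carrier (modm C)" using u(1) by blast
  moreover have "countable (carrier (modalisation C))"
    using carrier_modm_has_dia[OF SubAlgD(1)[OF CS] C(3)] C(2) modalisation_eq[OF SubAlgD(2)[OF CS]]
    by simp
  ultimately show thesis using that C(1) by blast
qed

text \<open>The valuation is returned in \<open>G\<close>, before \<open>e\<close> is applied, so
  that it can also be evaluated in the target of the quotient map.\<close>

lemma generatedE_common:
  assumes "x \<in> generated Q (e ` G)" "y \<in> generated Q (e ` G)"
  obtains g \<phi> \<psi> where "range g \<subseteq> G" "x = interp Q (\<lambda>p. e (g p)) \<phi>" "y = interp Q (\<lambda>p. e (g p)) \<psi>"
proof -
  have *: "\<exists>g \<phi>. range g \<subseteq> G \<and> x = interp Q (\<lambda>p. e (g p)) \<phi>" if x: "x \<in> generated Q (e ` G)" for x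
  proof -
    obtain v \<phi> where v: "range v \<subseteq> e ` G" "x = interp Q v \<phi>" using x unfolding generated_def by auto
    then have "\<forall>p. \<exists>m. m \<in> G \<and> v p = e m" by auto
    then obtain g where "\<And>p. g p \<in> G" "\<And>p. v p = e (g p)" by metis
    moreover from this have "v = (\<lambda>p. e (g p))" by auto
    ultimately show ?thesis using v by blast
  qed
  obtain g h \<phi> \<psi> where gh: "range g \<subseteq> G" "range h \<subseteq> G" "x = interp Q (\<lambda>p. e (g p)) \<phi>"
    "y = interp Q (\<lambda>p. e (h p)) \<psi>" using *[OF assms(1)] *[OF assms(2)] by blast
  obtain k \<sigma> \<tau> where k: "range k \<subseteq> range g \<union> range h"
    "interp Q (\<lambda>p. e (k p)) (subst \<sigma> \<phi>) = x" "interp Q (\<lambda>p. e (k p)) (subst \<tau> \<psi>) = y"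
    unfolding gh using merge_valuations[of g h] by metis
  have "range k \<subseteq> G" using k(1) gh(1,2) by blast
  then show thesis using that k(2,3) by metis
qed

lemma generated_image_interp:
  "range g \<subseteq> G \<Longrightarrow> interp Q (\<lambda>p. e (g p)) \<phi> \<in> generated Q (e ` G)"
  unfolding generated_def by (intro CollectI exI[of _ "\<lambda>p. e (g p)"] exI[of _ \<phi>]) auto

text \<open>Sending the value of a formula at \<open>e (g p)\<close> to its value at
  \<open>g p\<close> is the only possible homomorphism with \<open>e m\<close> going to
  \<open>m\<close>. By \<open>sep\<close> applied to biconditionals it is well defined, although
  \<open>e\<close> itself need not preserve any operation.\<close>

lemma generated_morphism:
  fixes M :: "'a modal" and Q :: "'b modal"
  assumes M: "modal_alg M" and Q: "modal_alg Q" and e: "e ` carrier M \<subseteq> carrier Q"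
    and sep: "\<And>\<chi> g. range g \<subseteq> carrier M \<Longrightarrow> interp Q (\<lambda>p. e (g p)) \<chi> = bone Q \<Longrightarrow>
      interp M g \<chi> = bone M"
  shows "morphic_image (sub_of_modal (Q\<lparr>carrier := generated Q (e ` carrier M)\<rparr>)) (sub_of_modal M)"
proof -
  let ?G = "carrier M" and ?e = "\<lambda>g :: nat \<Rightarrow> _. \<lambda>p. e (g p)"
  let ?S = "generated Q (e ` carrier M)"
  have eQ: "range (?e g) \<subseteq> carrier Q" if "range g \<subseteq> ?G" for g using e that by auto
  have sep1: "interp M g \<phi> = interp M g \<psi>"
    if g: "range g \<subseteq> ?G" and eq: "interp Q (?e g) \<phi> = interp Q (?e g) \<psi>" for g \<phi> \<psi>
    using sep[OF g, of "Iff \<phi> \<psi>"] interp_Iff_one[OF Q eQ[OF g], of \<phi> \<psi>] interp_Iff_one[OF M g, of \<phi> \<psi>] eq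
    by blast
  \<comment> \<open>One element may be given by two different valuations; merging these reduces to
    \<open>sep1\<close>. The merging acts on variables alone, so it serves \<open>M\<close> and
    \<open>Q\<close> simultaneously.\<close>
  have sep2: "interp M g \<phi> = interp M h \<psi>"
    if g: "range g \<subseteq> ?G" "range h \<subseteq> ?G" and eq: "interp Q (?e g) \<phi> = interp Q (?e h) \<psi>" for g h \<phi> \<psi>
  proof -
    obtain k \<sigma> \<tau> where k: "range k \<subseteq> range g \<union> range h"
      "\<forall>(N :: 'b modal) e \<phi>. interp N (\<lambda>p. e (k p)) (subst \<sigma> \<phi>) = interp N (\<lambda>p. e (g p)) \<phi>"
      "\<forall>(N :: 'b modal) e \<phi>. interp N (\<lambda>p. e (k p)) (subst \<tau> \<phi>) = interp N (\<lambda>p. e (h p)) \<phi>"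
      "\<forall>(N :: 'a modal) \<phi>. interp N k (subst \<sigma> \<phi>) = interp N g \<phi>"
      "\<forall>(N :: 'a modal) \<phi>. interp N k (subst \<tau> \<phi>) = interp N h \<phi>"
      by (rule merge_valuations[where 'a = 'b and g = g and h = h])
    have "range k \<subseteq> ?G" using k(1) g by blast
    then show ?thesis using sep1[of k "subst \<sigma> \<phi>" "subst \<tau> \<psi>"] eq by (simp add: k)
  qed
  define k where "k x = (THE m. \<exists>g \<phi>. range g \<subseteq> ?G \<and> x = interp Q (?e g) \<phi> \<and> m = interp M g \<phi>)" for x
  have k: "k (interp Q (?e g) \<phi>) = interp M g \<phi>" if "range g \<subseteq> ?G" for g \<phi>
    unfolding k_def
  proof (rule the_equality)
    show "\<exists>h \<psi>. range h \<subseteq> ?G \<and> interp Q (?e g) \<phi> = interp Q (?e h) \<psi> \<and> interp M g \<phi> = interp M h \<psi>"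
      using that by (intro exI[of _ g] exI[of _ \<phi>]) simp
    fix m assume "\<exists>h \<psi>. range h \<subseteq> ?G \<and> interp Q (?e g) \<phi> = interp Q (?e h) \<psi> \<and> m = interp M h \<psi>"
    then show "m = interp M g \<phi>" by (elim exE conjE) (simp add: sep2[OF that])
  qed
  have S: "modal_subuniverse Q ?S"
    by (rule modal_subuniverse_generated[OF Q e]) (use ba_closed(1)[OF modal_alg_boolean[OF M]] in blast)
  have SA: "modal_alg (Q\<lparr>carrier := ?S\<rparr>)" by (rule modal_alg_carrier_update[OF Q S])
  have "modal_hom (Q\<lparr>carrier := ?S\<rparr>) M k"
    unfolding modal_hom_def boolean_hom_def carrier_update_simps
  proof (intro conjI ballI)
    obtain m where m: "m \<in> ?G" using ba_closed(1)[OF modal_alg_boolean[OF M]] by blast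
    then have r: "range (\<lambda>_ :: nat. m) \<subseteq> ?G" by auto
    show "k (bzero Q) = bzero M" using k[OF r, of Bot] by simp
    show "k (bone Q) = bone M"
      using k[OF r, of "Disj Bot (Neg Bot)"] ba_units(4)[OF modal_alg_boolean[OF Q]]
        ba_units(4)[OF modal_alg_boolean[OF M]] ba_closed(1)[OF modal_alg_boolean[OF Q]]
        ba_closed(1)[OF modal_alg_boolean[OF M]] by simp
    show "k \<in> ?S \<rightarrow> carrier M"
    proof
      fix x assume "x \<in> ?S"
      then obtain g \<phi> where "range g \<subseteq> ?G" "x = interp Q (?e g) \<phi>"
        using generatedE_common[of x Q e ?G x] by metis
      then show "k x \<in> carrier M" using k interp_closed[OF M] by simp
    qed
  next
    fix x assume "x \<in> ?S"
    then obtain g \<phi> where g: "range g \<subseteq> ?G" "x = interp Q (?e g) \<phi>"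
      using generatedE_common[of x Q e ?G x] by metis
    show "k (neg Q x) = neg M (k x)" using k[OF g(1), of "Neg \<phi>"] k[OF g(1), of \<phi>] g by simp
    show "k (dia (Q\<lparr>carrier := ?S\<rparr>) x) = dia M (k x)" using k[OF g(1), of "Dia \<phi>"] k[OF g(1), of \<phi>] g by simp
  next
    fix x y assume "x \<in> ?S" "y \<in> ?S"
    then obtain g \<phi> \<psi> where g: "range g \<subseteq> ?G" "x = interp Q (?e g) \<phi>" "y = interp Q (?e g) \<psi>"
      by (rule generatedE_common)
    show "k (meet Q x y) = meet M (k x) (k y)" "k (join Q x y) = join M (k x) (k y)"
      using k[OF g(1), of "Conj \<phi> \<psi>"] k[OF g(1), of "Disj \<phi> \<psi>"] k[OF g(1)] g by simp_all
  qed
  then have "sub_morphism (sub_of_modal (Q\<lparr>carrier := ?S\<rparr>)) (sub_of_modal M) k"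
    by (rule modal_hom_sub_morphism[OF SA M])
  moreover have "k ` ?S = carrier M"
  proof
    show "k ` ?S \<subseteq> carrier M" 
      using \<open>modal_hom _ M k\<close> unfolding modal_hom_def boolean_hom_def by auto
    show "carrier M \<subseteq> k ` ?S"
    proof
      fix m assume "m \<in> carrier M"
      then have r: "range (\<lambda>_ :: nat. m) \<subseteq> ?G" by auto
      show "m \<in> k ` ?S"
        using k[OF r, of "Var 0"] generated_image_interp[OF r, of Q e "Var 0"]
        by (intro image_eqI[of _ _ "e m"]) simp_all
    qed
  qed
  ultimately show ?thesis unfolding morphic_image_def by auto
qed

text \<open>For each failure of a formula to be top in \<open>modm B\<close>, some coordinate of a
  product of modalisations from \<open>K\<close> shows the same failure. Hence \<open>modm B\<close>
  is a morphic image of a subalgebra of that product, and \<open>B\<close> follows by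
  reflection.\<close>

lemma scheme_class_subset_closed:
  assumes U: "is_universe TYPE('u)" and KS: "K \<subseteq> (SubAlg :: 'u subord set)"
    and cs: "closed_subalgebras K" and cm: "closed_morphic_images K"
    and mp: "modalised_products_condition K"
  shows "scheme_class (scheme_logic K) \<subseteq> K"
proof
  fix B :: "'u subord" assume B: "B \<in> scheme_class (scheme_logic K)"
  then have BS: "B \<in> SubAlg" and val: "\<And>\<phi>. \<phi> \<in> scheme_logic K \<Longrightarrow> mvalid (modm B) \<phi>"
    unfolding scheme_class_def using valid_schemes_iff by blast+
  note BA = SubAlgD(2)[OF BS]
  let ?M = "modm B"
  let ?G = "carrier ?M"
  let ?X = "{(\<chi>, g). range g \<subseteq> ?G \<and> interp ?M g \<chi> \<noteq> bone ?M}"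
  have M: "modal_alg ?M" by (rule modal_alg_modm[OF BA])
  define R where "R x C h \<longleftrightarrow> C \<in> K \<and> countable (carrier (modalisation C)) \<and>
      range h \<subseteq> carrier (modm C) \<and> interp (modm C) (\<lambda>p. h (snd x p)) (fst x) \<noteq> bone (modm C)"
    for x :: "fm \<times> (nat \<Rightarrow> 'u set set)" and C :: "'u subord" and h
  have "\<forall>x\<in>?X. \<exists>y. R x (fst y) (snd y)"
  proof
    fix x assume "x \<in> ?X"
    then have x: "range (snd x) \<subseteq> ?G" "interp ?M (snd x) (fst x) \<noteq> bone ?M" by auto
    have "\<exists>C h. R x C h"
      unfolding R_def
      by (rule countable_separation[OF U KS cs cm mp _ x]) (erule val, intro exI conjI)
    then show "\<exists>y. R x (fst y) (snd y)" by simp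
  qed
  then obtain F where F: "\<forall>x\<in>?X. R x (fst (F x)) (snd (F x))" by (rule bchoice[THEN exE])
  define C h where "C x = fst (F x)" and "h x = snd (F x)" for x
  have C: "C x \<in> K" "countable (carrier (modalisation (C x)))" "range (h x) \<subseteq> carrier (modm (C x))"
    "interp (modm (C x)) (\<lambda>p. h x (snd x p)) (fst x) \<noteq> bone (modm (C x))" if "x \<in> ?X" for x
    using bspec[OF F that] unfolding R_def C_def h_def by blast+
  have "small TYPE('u) (carrier (modalisation B))"
    using small_modalisation[OF U] BS BA unfolding SubAlg_def by blast
  then have sG: "small TYPE('u) ?G" by (simp add: modalisation_eq[OF BA])
  have "small TYPE('u) ((UNIV :: fm set) \<times> {g :: nat \<Rightarrow> _. range g \<subseteq> ?G})"
    by (intro small_Times[OF U] small_valuations[OF U sG] small_countable[OF U]) simp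
  then have sX: "small TYPE('u) ?X" by (rule small_lepoll) (rule subset_imp_lepoll, auto)
  \<comment> \<open>The products condition takes index sets in \<open>'u\<close>, so the small set
    of refuted pairs is renamed injectively; \<kappa> undoes the renaming.\<close>
  then obtain \<iota> :: "_ \<Rightarrow> 'u" where \<iota>: "inj_on \<iota> ?X"
    unfolding small_def lesspoll_def lepoll_def by auto
  define I where "I = \<iota> ` ?X"
  define \<kappa> where "\<kappa> = inv_into ?X \<iota>"
  have \<kappa>: "\<kappa> i \<in> ?X" if "i \<in> I" for i using that unfolding I_def \<kappa>_def by (rule inv_into_into)
  have \<kappa>\<iota>: "\<kappa> (\<iota> x) = x" if "x \<in> ?X" for x using that \<iota> unfolding \<kappa>_def by (rule inv_into_f_f[rotated])
  have CK: "C (\<kappa> i) \<in> K" "C (\<kappa> i) \<in> SubAlg" if "i \<in> I" for i using C(1)[OF \<kappa>[OF that]] KS by auto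
  have sI: "small TYPE('u) I" unfolding I_def by (rule small_lepoll[OF sX image_lepoll])
  let ?P = "prod_alg I (\<lambda>i. modalisation (C (\<kappa> i)))"
  have "small TYPE('u) (carrier ?P)"
    unfolding prod_alg_simps by (rule small_PiE_countable[OF U sI C(2)[OF \<kappa>]])
  then have bP: "belongs ?P K"
    using mp[unfolded modalised_products_condition_def, rule_format, of I "\<lambda>i. C (\<kappa> i)"] sI CK by blast
  define Q where "Q = mprod I (\<lambda>i. modm (C (\<kappa> i)))"
  have PQ: "?P = sub_of_modal Q"
    unfolding Q_def prod_alg_sub_of_modal[symmetric]
    by (rule prod_alg_cong) (rule modalisation_eq[OF SubAlgD(2)[OF CK(2)]])
  have Q: "modal_alg Q"
    unfolding Q_def by (intro modal_alg_mprod modal_alg_modm SubAlgD(2) CK(2))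
  \<comment> \<open>The tuple collecting the images of \<open>m\<close> under all refuting
    maps.\<close>
  define e where "e m = (\<lambda>i\<in>I. h (\<kappa> i) m)" for m
  have e: "e m \<in> carrier Q" for m
    using C(3)[OF \<kappa>] unfolding e_def Q_def mprod_def by (auto simp del: modm_simps)
  let ?S = "generated Q (e ` ?G)"
  have "morphic_image (sub_of_modal (Q\<lparr>carrier := ?S\<rparr>)) (sub_of_modal ?M)"
  proof (rule generated_morphism[OF M Q])
    show "e ` ?G \<subseteq> carrier Q" using e by auto
    fix \<chi> and g :: "nat \<Rightarrow> _" assume g: "range g \<subseteq> ?G" and one: "interp Q (\<lambda>p. e (g p)) \<chi> = bone Q"
    show "interp ?M g \<chi> = bone ?M"
    proof (rule ccontr)
      assume "\<not> ?thesis"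
      then have x: "(\<chi>, g) \<in> ?X" using g by auto
      \<comment> \<open>The coordinate indexed by the pair itself was chosen to refute \<chi> at
        \<open>g\<close>, so the value in \<open>Q\<close> cannot be top there.\<close>
      define i where "i = \<iota> (\<chi>, g)"
      have i: "i \<in> I" "\<kappa> i = (\<chi>, g)" using x \<kappa>\<iota>[OF x] unfolding i_def I_def by auto
      have "interp Q (\<lambda>p. e (g p)) \<chi> i = interp (modm (C (\<kappa> i))) (\<lambda>p. e (g p) i) \<chi>"
        unfolding Q_def by (rule interp_mprod[OF i(1)])
      also have "(\<lambda>p. e (g p) i) = (\<lambda>p. h (\<kappa> i) (g p))" using i(1) by (simp add: e_def)
      finally have "interp (modm (C (\<kappa> i))) (\<lambda>p. h (\<kappa> i) (g p)) \<chi> = bone (modm (C (\<kappa> i)))"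
        using one i(1) by (simp add: Q_def mprod_def)
      then show False using C(4)[OF x] i by simp
    qed
  qed
  moreover have S: "modal_subuniverse Q ?S"
    by (rule modal_subuniverse_generated[OF Q])
      (use e ba_closed(1)[OF modal_alg_boolean[OF M]] in blast)+
  have "belongs ((sub_of_modal Q)\<lparr>carrier := ?S\<rparr>) K"
    by (rule belongs_subalgebra[OF KS cs bP[unfolded PQ] _ sub_subuniverse_of_modal[OF Q S]])
      (simp add: modal_alg_boolean[OF Q])
  ultimately have "belongs (sub_of_modal ?M) K"
    unfolding sub_of_modal_carrier_update
    using belongs_morphic_image[OF KS cm, of "sub_of_modal (Q\<lparr>carrier := ?S\<rparr>)" "sub_of_modal ?M"]
      subordination_alg_sub_of_modal[OF M] modal_alg_boolean[OF modal_alg_carrier_update[OF Q S]] by simp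
  then show "B \<in> K"
    using belongs_modalisation_iff[OF U KS cm mp BS] modalisation_eq[OF BA] by simp
qed

theorem theorem3p15:
  fixes K :: "'u subord set"
  assumes "is_universe TYPE('u)"
    and "K \<subseteq> SubAlg"
  shows "((\<exists>L. normal_modal_logic L \<and> K = Mod L) \<longleftrightarrow> definable_by_schemes K)
    \<and> (definable_by_schemes K \<longleftrightarrow>
         closed_subalgebras K \<and> closed_morphic_images K \<and> closed_good_products K \<and>
         closed_modalisation K \<and> reflects_modalisation K)
    \<and> (closed_subalgebras K \<and> closed_morphic_images K \<and> closed_good_products K \<and>
         closed_modalisation K \<and> reflects_modalisation K \<longleftrightarrow>
       closed_subalgebras K \<and> closed_morphic_images K \<and> modalised_products_condition K)"
proof -
  let ?closed = "closed_subalgebras K \<and> closed_morphic_images K \<and> closed_good_products K \<and>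
    closed_modalisation K \<and> reflects_modalisation K"
  have schemes: "?closed" if def: "definable_by_schemes K"
  proof -
    obtain \<Gamma> where "K = scheme_class \<Gamma>" using def unfolding definable_by_schemes_iff by (rule exE)
    then show ?thesis using scheme_class_closed[OF assms(1)] by (intro conjI)
  qed
  have closed: "modalised_products_condition K" if cl: "?closed"
    using cl by (elim conjE) (rule closed_imp_modalised_products_condition[OF assms(2)])
  have products: "definable_by_schemes K"
    if "closed_subalgebras K" "closed_morphic_images K" "modalised_products_condition K"
    unfolding definable_by_schemes_iff
    using equalityI[OF subset_scheme_class[OF assms(2)] scheme_class_subset_closed[OF assms that]]
    by (rule exI)
  have eq: "definable_by_schemes K \<longleftrightarrow> ?closed"
  proof
    assume cl: "?closed"
    show "definable_by_schemes K"
      by (rule products[OF conjunct1[OF cl] conjunct1[OF conjunct2[OF cl]] closed[OF cl]])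
  qed (rule schemes)
  have eq': "?closed \<longleftrightarrow>
      closed_subalgebras K \<and> closed_morphic_images K \<and> modalised_products_condition K"
  proof
    assume cl: "?closed"
    show "closed_subalgebras K \<and> closed_morphic_images K \<and> modalised_products_condition K"
      using conjunct1[OF cl] conjunct1[OF conjunct2[OF cl]] closed[OF cl] by (intro conjI)
  next
    assume "closed_subalgebras K \<and> closed_morphic_images K \<and> modalised_products_condition K"
    \<comment> \<open>Closure under arbitrary good products is not derived from the products
      condition directly, but by passing through definability by schemes.\<close>
    then show "?closed" by (elim conjE) (rule schemes[OF products])
  qed
  from Mod_iff_definable_by_schemes eq eq' show ?thesis by (rule conjI[OF _ conjI])
qed

end
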